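(* Let $d\ge 1$ and let $A_1,A_2:\mathbb{R}^d\to\mathbb{R}^d$ be self-adjoint expansive linear maps. For $\mu=1,2$ write $A_\mu=C_\mu J_\mu C_\mu^{-1}$, where $C_\mu$ is an invertible linear map and $J_\mu=\mathrm{diag}(\lambda_1^{(\mu)},\dots,\lambda_d^{(\mu)})$ is a real diagonal matrix, and put $A'_\mu=C_\mu J'_\mu C_\mu^{-1}$ with $J'_\mu=\mathrm{diag}(|\lambda_1^{(\mu)}|,\dots,|\lambda_d^{(\mu)}|)$. Then $\mathcal{E}_{A_1}=\mathcal{E}_{A_2}$ if and only if there exists $t>0$ such that $(A'_1)^t=A'_2$. Moreover, suppose that $A_1$ and $A_2$ are both diagonal with respect to the canonical basis of $\mathbb{R}^d$. If $A_1$ and $A_2$ are trivially equivalent, then $A_1(\mathbb{Z}^d)\subset\mathbb{Z}^d$ and $A_2(\mathbb{Z}^d)\subset\mathbb{Z}^d$, and thus $A_1,A_2$ form two equivalent expansive linear maps for MRA (i.e. both preserve $\mathbb{Z}^d$ in this sense and $\mathcal{E}_{A_1}=\mathcal{E}_{A_2}$).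
   Context: $\mathbb{R}^d$ carries the Euclidean norm and $|\cdot|_d$ is $d$-dimensional Lebesgue measure; $B_r=\{\mathbf{x}\in\mathbb{R}^d:\|\mathbf{x}\|<r\}$. A linear map $A:\mathbb{R}^d\to\mathbb{R}^d$ is expansive if all its (complex) eigenvalues have absolute value greater than $1$. For an expansive linear map $A$, $\mathcal{E}_A$ is the family of all measurable sets $E\subset\mathbb{R}^d$ with $|E|_d>0$ for which the origin is a point of $A$-density, i.e. for all $r>0$, $$\lim_{j\to\infty}\frac{|E\cap A^{-j}B_r|_d}{|A^{-j}B_r|_d}=1.$$ Real powers: if $A=CJC^{-1}$ with $C$ invertible and $J$ diagonal with positive diagonal entries $\lambda_1,\dots,\lambda_d$, then $A^t=CJ^tC^{-1}$, where $J^t$ is the diagonal matrix with entries $\lambda_1^t,\dots,\lambda_d^t$. Trivial equivalence: with $A_\mu,J_\mu,A'_\mu$ as in the claim, $A_1$ and $A_2$ are trivially equivalent if $(A'_1)^t=A'_2$ for some $t>0$ such that either (1) $t=p/q$ with $p,q$ positive integers and every $|\lambda_j^{(1)}|$ ($j=1,\dots,d$) is a full $q$-th power of some (possibly different) natural number; or (2) there are natural numbers $a,b$ and positive integers $n_1,\dots,n_d$ with $|\lambda_j^{(1)}|=a^{n_j}$ for $j=1,\dots,d$, and, with $q=\gcd(n_1,\dots,n_d)$, $t=\frac{m}{q}\cdot\frac{\log b}{\log a}$ for some positive integer $m$. *)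

theory Defs
  imports "HOL-Analysis.Analysis"
begin

definition complex_eigenvalue :: "(real^'n \<Rightarrow> real^'n) \<Rightarrow> complex \<Rightarrow> bool" where
  "complex_eigenvalue A z \<longleftrightarrow>
     (\<exists>v :: complex^'n. v \<noteq> 0 \<and>
        map_matrix complex_of_real (matrix A) *v v = z *s v)"

definition expansive :: "(real^'n \<Rightarrow> real^'n) \<Rightarrow> bool" where
  "expansive A \<longleftrightarrow> linear A \<and> (\<forall>z. complex_eigenvalue A z \<longrightarrow> 1 < cmod z)"

(* Only |E| > 0 needs emeasure (E may have infinite measure); the sets in the quotient are
   bounded, so the real-valued measure is the true one there. *)
definition density_family :: "(real^'n \<Rightarrow> real^'n) \<Rightarrow> (real^'n) set set" where
  "density_family A =
     {E \<in> sets lebesgue. emeasure lebesgue E > 0 \<and>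
        (\<forall>r>0. (\<lambda>j. measure lebesgue (E \<inter> (inv A ^^ j) ` ball 0 r) /
                     measure lebesgue ((inv A ^^ j) ` ball 0 r)) \<longlonglongrightarrow> 1)}"

definition diag_map :: "('n \<Rightarrow> real) \<Rightarrow> real^'n \<Rightarrow> real^'n" where
  "diag_map l x = (\<chi> i. l i * x $ i)"

definition linear_powr :: "(real^'n \<Rightarrow> real^'n) \<Rightarrow> real \<Rightarrow> real^'n \<Rightarrow> real^'n" where
  "linear_powr A t =
     (THE B. \<exists>(C :: real^'n \<Rightarrow> real^'n) l. linear C \<and> bij C \<and> (\<forall>i. 0 < l i) \<and>
        A = C \<circ> diag_map l \<circ> inv C \<and> B = C \<circ> diag_map (\<lambda>i. l i powr t) \<circ> inv C)"

lemma diag_map_intertwine_powr: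
  fixes P :: "real^'n \<Rightarrow> real^'n"
  assumes P: "linear P" and l: "\<forall>i. 0 < l i" and k: "\<forall>i. 0 < k i"
    and eq: "P \<circ> diag_map l = diag_map k \<circ> P"
  shows "P \<circ> diag_map (\<lambda>i. l i powr t) = diag_map (\<lambda>i. k i powr t) \<circ> P"
proof -
  have ax: "diag_map m (axis j 1) = m j *\<^sub>R axis j 1" for m :: "'n \<Rightarrow> real" and j
    by (auto simp: diag_map_def axis_def vec_eq_iff)
  have entry: "l j * P (axis j 1) $ i = k i * P (axis j 1) $ i" for i j
  proof -
    have "P (diag_map l (axis j 1)) = diag_map k (P (axis j 1))"
      using eq by (metis comp_apply)
    then have "l j *\<^sub>R P (axis j 1) = diag_map k (P (axis j 1))"
      by (simp add: ax linear_cmul[OF P])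
    then show ?thesis by (simp add: diag_map_def vec_eq_iff)
  qed
  have lin: "linear (diag_map m)" for m :: "'n \<Rightarrow> real"
    by (rule linearI) (auto simp: diag_map_def vec_eq_iff algebra_simps)
  show ?thesis
  proof (rule linear_eq_stdbasis)
    show "linear (P \<circ> diag_map (\<lambda>i. l i powr t))" by (rule linear_compose[OF lin P])
    show "linear (diag_map (\<lambda>i. k i powr t) \<circ> P)" by (rule linear_compose[OF P lin])
    fix b :: "real^'n" assume "b \<in> Basis"
    then obtain j where b: "b = axis j 1" by (auto simp: Basis_vec_def)
    have "l j powr t * P (axis j 1) $ i = k i powr t * P (axis j 1) $ i" for i
      using entry[of j i] by (cases "P (axis j 1) $ i = 0") auto
    then show "(P \<circ> diag_map (\<lambda>i. l i powr t)) b = (diag_map (\<lambda>i. k i powr t) \<circ> P) b"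
      by (simp add: b ax linear_cmul[OF P]) (simp add: diag_map_def vec_eq_iff)
  qed
qed

lemma linear_powr_eq:
  fixes C :: "real^'n \<Rightarrow> real^'n"
  assumes C: "linear C" "bij C" and l: "\<forall>i. 0 < l i"
  shows "linear_powr (C \<circ> diag_map l \<circ> inv C) t = C \<circ> diag_map (\<lambda>i. l i powr t) \<circ> inv C"
  unfolding linear_powr_def
proof (rule the_equality)
  show "\<exists>(C' :: real^'n \<Rightarrow> real^'n) k. linear C' \<and> bij C' \<and> (\<forall>i. 0 < k i) \<and>
          C \<circ> diag_map l \<circ> inv C = C' \<circ> diag_map k \<circ> inv C' \<and>
          C \<circ> diag_map (\<lambda>i. l i powr t) \<circ> inv C = C' \<circ> diag_map (\<lambda>i. k i powr t) \<circ> inv C'"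
    using C l by blast
next
  fix B
  assume "\<exists>(C' :: real^'n \<Rightarrow> real^'n) k. linear C' \<and> bij C' \<and> (\<forall>i. 0 < k i) \<and>
            C \<circ> diag_map l \<circ> inv C = C' \<circ> diag_map k \<circ> inv C' \<and>
            B = C' \<circ> diag_map (\<lambda>i. k i powr t) \<circ> inv C'"
  then obtain C' :: "real^'n \<Rightarrow> real^'n" and k where C': "linear C'" "bij C'" and k: "\<forall>i. 0 < k i"
    and eq: "C \<circ> diag_map l \<circ> inv C = C' \<circ> diag_map k \<circ> inv C'"
    and B: "B = C' \<circ> diag_map (\<lambda>i. k i powr t) \<circ> inv C'"
    by blast
  have inv: "C (inv C x) = x" "inv C (C x) = x" "C' (inv C' x) = x" "inv C' (C' x) = x" for x
    using C(2) C'(2) by (simp_all add: bij_is_inj bij_is_surj surj_f_inv_f)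
  have "linear (inv C')"
    using C' by (metis bij_is_inj bij_is_surj eq_id_iff inj_iff left_right_inverse_eq
        linear_injective_left_inverse surj_iff)
  then have P: "linear (inv C' \<circ> C)" using C(1) linear_compose by blast
  have "(inv C' \<circ> C) \<circ> diag_map l = diag_map k \<circ> (inv C' \<circ> C)"
  proof
    fix x
    show "((inv C' \<circ> C) \<circ> diag_map l) x = (diag_map k \<circ> (inv C' \<circ> C)) x"
      using fun_cong[OF eq, of "C x"] by (simp add: inv)
  qed
  from diag_map_intertwine_powr[OF P l k this, of t]
  have "inv C' (C (diag_map (\<lambda>i. l i powr t) y)) = diag_map (\<lambda>i. k i powr t) (inv C' (C y))" for y
    by (simp add: fun_eq_iff)
  then have "C (diag_map (\<lambda>i. l i powr t) (inv C x))
           = C' (diag_map (\<lambda>i. k i powr t) (inv C' x))" for x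
    by (metis inv)
  then show "B = C \<circ> diag_map (\<lambda>i. l i powr t) \<circ> inv C"
    by (simp add: B fun_eq_iff)
qed

(* The arguments are the eigenvalues of the first map and the moduli A1', A2' of both maps.
   The degenerate values a, b \<le> 1 are harmless: ln 0 = ln 1 = 0 and division by 0 would make
   t = 0. *)
definition trivially_equivalent ::
    "('n \<Rightarrow> real) \<Rightarrow> (real^'n \<Rightarrow> real^'n) \<Rightarrow> (real^'n \<Rightarrow> real^'n) \<Rightarrow> bool" where
  "trivially_equivalent l1 A1' A2' \<longleftrightarrow>
     (\<exists>t>0. linear_powr A1' t = A2' \<and>
        ((\<exists>p q :: nat. 0 < p \<and> 0 < q \<and> t = real p / real q \<and>
            (\<forall>j. \<exists>k :: nat. \<bar>l1 j\<bar> = real k ^ q)) \<or>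
         (\<exists>(a :: nat) (b :: nat) (n :: 'n \<Rightarrow> nat) (m :: nat).
            (\<forall>j. 0 < n j \<and> \<bar>l1 j\<bar> = real a ^ n j) \<and> 0 < m \<and>
            t = real m / real (Gcd (range n)) * (ln (real b) / ln (real a)))))"

definition integer_lattice :: "(real^'n) set" where
  "integer_lattice = {x. \<forall>i. x $ i \<in> \<int>}"

end

(* Write a diagonalizable map with eigenvalues of modulus > 1 as C diag(l) C^-1. Signs of the l i and the
   rounding of j to a real time s only distort the sets A^-j B_r by bounded factors, so membership
   in the density family depends only on the flow s |-> C diag(|l i|^s) C^-1, hence is unchanged
   by passing to |A|^t. Conversely normalise both flows to volume growth e^s, with exponents
   alpha and beta. If column i of C1 and column j of C2 are not orthogonal and alpha i < beta j,
   then the sets of the first flow are, in the scale of the second one, stretched without bound and therefore thin.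
   Deleting suitable pieces of them gives a set that is dense at 0 for the second flow only. So
   non-orthogonal columns have equal exponents, and by self-adjointness |A1|^t and |A2| have the same
   inner products against all pairs of columns. *)
theory Submission imports Defs begin

text \<open>The columns of \<open>C1\<close> and \<open>C2\<close> are arbitrary bases and
  eigenvalues may repeat, so the two spectral decompositions cannot be lined up index by index.
  Everything is expressed through the pairings \<open>C1 (axis i 1) \<bullet> C2 (axis j 1)\<close>:
  a nonzero one forces equal normalised exponents, a vanishing one imposes nothing. Thinness is
  tested by a single functional, the inner product with a column v of the second basis.
  Self-adjointness makes it scale exactly like exp (- \<beta> j * s) under the second flow at time
  -s, while a column u of the first basis with u \<bullet> v nonzero keeps its maximum on the first
  flowed ball at least of order exp (- \<alpha> i * s). Exponents of sum 1 give the balls of both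
  flows volume of order exp (- s), so sets at a common time can be compared; this is why t comes out
  as the ratio of the two numbers ln |det|. Density is a limit, so it must be spoiled at infinitely
  many scales for one flow while all the deletions together stay negligible for the other. The
  strict comparison gives one inequality between exponents; swapping the roles of the maps gives the
  other.\<close>

subsection \<open>Linear images of Lebesgue measurable sets\<close>

text \<open>The library computes the measure of a linear image by a determinant only over a well-ordered index
  type. An arbitrary finite index type is carried over to a well-ordered copy of itself.\<close>

typedef 'a well_ordered = "UNIV :: 'a set" ..

lemma finite_UNIV_well_ordered: "finite (UNIV :: 'a::finite well_ordered set)"
  using finite_imageI[of "UNIV :: 'a set" Abs_well_ordered]
    type_definition.Abs_image[OF type_definition_well_ordered]
  by (metis finite)

definition well_ordered_rank :: "'a::finite well_ordered \<Rightarrow> nat" where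
  "well_ordered_rank = (SOME f. inj f)"

lemma inj_well_ordered_rank: "inj (well_ordered_rank :: 'a::finite well_ordered \<Rightarrow> nat)"
proof -
  have "\<exists>f :: 'a well_ordered \<Rightarrow> nat. inj f"
    using finite_imp_inj_to_nat_seg[OF finite_UNIV_well_ordered] by blast
  then show ?thesis unfolding well_ordered_rank_def by (rule someI_ex)
qed

instantiation well_ordered :: (finite) "{finite, wellorder}"
begin

definition less_eq_well_ordered :: "'a well_ordered \<Rightarrow> 'a well_ordered \<Rightarrow> bool" where
  "x \<le> y \<longleftrightarrow> well_ordered_rank x \<le> well_ordered_rank y"

definition less_well_ordered :: "'a well_ordered \<Rightarrow> 'a well_ordered \<Rightarrow> bool" where
  "x < y \<longleftrightarrow> well_ordered_rank x < well_ordered_rank y"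

instance
proof
  show "finite (UNIV :: 'a well_ordered set)"
    by (rule finite_UNIV_well_ordered)
  fix P :: "'a well_ordered \<Rightarrow> bool" and a :: "'a well_ordered"
  assume step: "\<And>x. (\<And>y. y < x \<Longrightarrow> P y) \<Longrightarrow> P x"
  show "P a"
    by (induction a rule: measure_induct_rule[of well_ordered_rank])
      (rule step, simp add: less_well_ordered_def)
qed (use inj_well_ordered_rank in \<open>auto simp: less_eq_well_ordered_def less_well_ordered_def inj_def\<close>)

end

definition reindex :: "real^'n \<Rightarrow> real^'n well_ordered" where
  "reindex x = (\<chi> i. x $ Rep_well_ordered i)"

definition unreindex :: "real^'n well_ordered \<Rightarrow> real^'n" where
  "unreindex x = (\<chi> i. x $ Abs_well_ordered i)"

lemma unreindex_reindex [simp]: "unreindex (reindex x) = x" "reindex (unreindex y) = y"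
  by (simp_all add: reindex_def unreindex_def vec_eq_iff Abs_well_ordered_inverse Rep_well_ordered_inverse)

lemma linear_reindex: "linear reindex"
  by (rule linearI) (auto simp: reindex_def vec_eq_iff)

lemma linear_unreindex: "linear unreindex"
  by (rule linearI) (auto simp: unreindex_def vec_eq_iff)

lemma bij_Rep_well_ordered: "bij Rep_well_ordered"
  by (rule bij_betw_byWitness[of _ Abs_well_ordered])
    (auto simp: Abs_well_ordered_inverse Rep_well_ordered_inverse)

lemma prod_Basis_cart: "(\<Prod>b\<in>Basis. x \<bullet> b) = (\<Prod>i\<in>UNIV. x $ i)"
  for x :: "real^'n"
proof -
  have "Basis = range (\<lambda>i. axis i 1 :: real^'n)"
    by (auto simp: Basis_vec_def)
  moreover have "inj (\<lambda>i. axis i 1 :: real^'n)"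
    by (auto simp: inj_def axis_eq_axis)
  ultimately show ?thesis
    using prod.reindex[of "\<lambda>i. axis i 1" UNIV "\<lambda>b. x \<bullet> b"] by (simp add: inner_axis)
qed

text \<open>Renaming coordinates carries boxes to boxes with the same side lengths, and box measures
  determine \<open>lborel\<close>. Compactness makes both sets Borel, where \<open>lebesgue\<close>
  and \<open>lborel\<close> agree.\<close>

lemma measure_reindex_image:
  fixes S :: "(real^'n) set"
  assumes "compact S"
  shows "measure lebesgue (reindex ` S) = measure lebesgue S"
proof -
  have [measurable]: "unreindex \<in> borel_measurable borel" "reindex \<in> borel_measurable borel"
    using linear_unreindex linear_reindex
    by (auto intro!: borel_measurable_continuous_onI linear_continuous_on simp: linear_conv_bounded_linear)
  have "lborel = distr lborel borel (unreindex :: real^'n well_ordered \<Rightarrow> real^'n)"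
  proof (rule lborel_eqI)
    fix l u :: "real^'n" assume lu: "\<And>b. b \<in> Basis \<Longrightarrow> l \<bullet> b \<le> u \<bullet> b"
    have "unreindex -` box l u = box (reindex l) (reindex u)"
      by (auto simp: mem_box_cart reindex_def unreindex_def)
        (metis Rep_well_ordered_inverse Abs_well_ordered_inverse UNIV_I)+
    moreover have "(\<Prod>i\<in>UNIV. reindex u $ i - reindex l $ i) = (\<Prod>i\<in>UNIV. u $ i - l $ i)"
      unfolding reindex_def using prod.reindex_bij_betw[OF bij_Rep_well_ordered, of "\<lambda>i. u $ i - l $ i"]
      by simp
    moreover have le: "\<forall>b\<in>Basis. reindex l \<bullet> b \<le> reindex u \<bullet> b"
      using lu[OF axis_in_Basis_iff[THEN iffD2]]
      by (auto simp: Basis_vec_def reindex_def inner_axis)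
    ultimately show "emeasure (distr lborel borel unreindex) (box l u) = (\<Prod>b\<in>Basis. (u - l) \<bullet> b)"
      using le by (simp add: emeasure_distr emeasure_lborel_box_eq prod_Basis_cart)
  qed simp
  then have "measure lborel S = measure (distr lborel borel (unreindex :: real^'n well_ordered \<Rightarrow> real^'n)) S"
    by (rule arg_cong)
  also have "\<dots> = measure lborel (unreindex -` S)"
    using assms measure_distr[of unreindex lborel borel S] by (simp add: borel_compact)
  finally have "measure lborel S = measure lborel (unreindex -` S)" .
  moreover have "unreindex -` S = reindex ` S"
    by (auto simp: image_iff) (metis unreindex_reindex(2))
  moreover have "compact (reindex ` S)"
    using assms linear_reindex
    by (intro compact_continuous_image linear_continuous_on) (auto simp: linear_conv_bounded_linear)
  ultimately show ?thesis
    using assms by (simp add: borel_compact)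
qed

text \<open>Conjugation with \<open>reindex\<close> moves the map to the well-ordered index type,
  where the determinant formula applies. Boxes suffice, and their linear images are compact, so the
  measure can be carried back.\<close>

lemma measure_linear_image_cart:
  fixes f :: "real^'n \<Rightarrow> real^'n"
  assumes "linear f" "S \<in> lmeasurable"
  shows "f ` S \<in> lmeasurable"
    and "measure lebesgue (f ` S) = \<bar>det (matrix (reindex \<circ> f \<circ> unreindex))\<bar> * measure lebesgue S"
proof -
  have lin: "linear (reindex \<circ> f \<circ> unreindex)"
    by (intro linear_compose linear_reindex linear_unreindex assms)
  have "measure lebesgue (f ` cbox a b) =
      \<bar>det (matrix (reindex \<circ> f \<circ> unreindex))\<bar> * measure lebesgue (cbox a b)" for a b
  proof -
    have "compact (f ` cbox a b)"
      using assms(1) by (intro compact_continuous_image linear_continuous_on) (auto simp: linear_conv_bounded_linear)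
    then have "measure lebesgue (f ` cbox a b) = measure lebesgue (reindex ` f ` cbox a b)"
      by (simp add: measure_reindex_image)
    also have "reindex ` f ` cbox a b = (reindex \<circ> f \<circ> unreindex) ` (reindex ` cbox a b)"
      by (simp add: image_comp o_def)
    also have "measure lebesgue \<dots> = \<bar>det (matrix (reindex \<circ> f \<circ> unreindex))\<bar> * measure lebesgue (reindex ` cbox a b)"
      by (intro measure_linear_image lin measurable_linear_image_interval linear_reindex)
    finally show ?thesis by (simp add: measure_reindex_image)
  qed
  from measure_linear_sufficient[OF assms this]
  show "f ` S \<in> lmeasurable"
    and "measure lebesgue (f ` S) = \<bar>det (matrix (reindex \<circ> f \<circ> unreindex))\<bar> * measure lebesgue S"
    by simp_all
qed

subsection \<open>Maps diagonal in the columns of a fixed isomorphism\<close>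

definition diag_wrt :: "(real^'n \<Rightarrow> real^'n) \<Rightarrow> ('n \<Rightarrow> real) \<Rightarrow> real^'n \<Rightarrow> real^'n" where
  "diag_wrt C m = C \<circ> diag_map m \<circ> inv C"

lemma linear_diag_map: "linear (diag_map m)"
  by (rule linearI) (auto simp: diag_map_def vec_eq_iff algebra_simps)

lemma linear_inv_bij:
  fixes C :: "real^'n \<Rightarrow> real^'n"
  assumes "linear C" "bij C"
  shows "linear (inv C)"
  using assms by (metis bij_is_inj bij_is_surj eq_id_iff inj_iff left_right_inverse_eq
        linear_injective_left_inverse surj_iff)

lemma diag_map_axis: "diag_map m (axis i 1) = m i *\<^sub>R axis i 1"
  by (auto simp: diag_map_def axis_def vec_eq_iff)

lemma norm_diag_map_le:
  assumes "\<And>i. \<bar>m i\<bar> \<le> c"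
  shows "norm (diag_map m x) \<le> c * norm x"
proof -
  \<comment> \<open>The index type is nonempty, so any one instance of the bound shows
    \<open>c\<close> nonnegative.\<close>
  have c: "0 \<le> c" using assms[of undefined] by linarith
  have "norm (diag_map m x) \<le> norm (c *\<^sub>R x)"
    by (rule norm_le_componentwise_cart)
      (use assms c in \<open>auto simp: diag_map_def abs_mult intro!: mult_right_mono\<close>)
  then show ?thesis using c by simp
qed

context
  fixes C :: "real^'n \<Rightarrow> real^'n"
  assumes C: "linear C" "bij C"
begin

lemma inv_bij_cancel: "inv C (C x) = x" "C (inv C x) = x"
  using C(2) by (simp_all add: bij_is_inj bij_is_surj surj_f_inv_f)

lemma linear_diag_wrt: "linear (diag_wrt C m)"
  unfolding diag_wrt_def
  by (intro linear_compose linear_inv_bij linear_diag_map C)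

lemma diag_wrt_diag_wrt: "diag_wrt C m (diag_wrt C k x) = diag_wrt C (\<lambda>i. m i * k i) x"
  by (simp add: diag_wrt_def diag_map_def mult.assoc inv_bij_cancel)

lemma diag_wrt_one: "diag_wrt C (\<lambda>i. 1) x = x"
  by (simp add: diag_wrt_def diag_map_def inv_bij_cancel)

lemma diag_wrt_column: "diag_wrt C m (C (axis i 1)) = m i *\<^sub>R C (axis i 1)"
  by (simp add: diag_wrt_def diag_map_axis inv_bij_cancel linear_cmul[OF C(1)])

text \<open>The determinants of \<open>C\<close> and \<open>inv C\<close> cancel, so the volume
  factor is the product of the |m i|, whatever basis the columns form.\<close>

lemma diag_wrt_image:
  assumes S: "S \<in> lmeasurable"
  shows lmeasurable_diag_wrt_image: "diag_wrt C m ` S \<in> lmeasurable"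
    and measure_diag_wrt_image:
      "measure lebesgue (diag_wrt C m ` S) = (\<Prod>i\<in>UNIV. \<bar>m i\<bar>) * measure lebesgue S"
proof -
  let ?P = "reindex \<circ> C \<circ> unreindex" and ?Q = "reindex \<circ> inv C \<circ> unreindex"
  let ?D = "diag_map (m \<circ> Rep_well_ordered)"
  have lin: "linear ?P" "linear ?Q"
    by (intro linear_compose linear_reindex linear_unreindex linear_inv_bij C)+
  have "reindex \<circ> diag_wrt C m \<circ> unreindex = ?P \<circ> ?D \<circ> ?Q"
  proof -
    have "diag_map m = unreindex \<circ> ?D \<circ> reindex"
      by (auto simp: fun_eq_iff diag_map_def reindex_def unreindex_def vec_eq_iff Abs_well_ordered_inverse)
    then show ?thesis by (simp add: diag_wrt_def o_def)
  qed
  then have "det (matrix (reindex \<circ> diag_wrt C m \<circ> unreindex)) =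
      (det (matrix ?P) * det (matrix ?Q)) * det (matrix ?D)"
    by (simp only: matrix_compose lin linear_compose linear_diag_map det_mul mult_ac)
  moreover have "det (matrix ?P) * det (matrix ?Q) = 1"
  proof -
    have "det (matrix ?P) * det (matrix ?Q) = det (matrix (?P \<circ> ?Q))"
      by (simp only: matrix_compose lin det_mul)
    also have "?P \<circ> ?Q = id" by (simp add: fun_eq_iff inv_bij_cancel)
    finally show ?thesis by (simp only: matrix_id)
  qed
  moreover have "det (matrix ?D) = (\<Prod>i\<in>UNIV. m i)"
  proof -
    have "det (matrix ?D) = (\<Prod>i\<in>UNIV. matrix ?D $ i $ i)"
      by (rule det_diagonal) (simp add: matrix_def diag_map_def axis_def)
    also have "\<dots> = (\<Prod>i\<in>UNIV. m (Rep_well_ordered i))"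
      by (simp add: matrix_def diag_map_def axis_def)
    also have "\<dots> = (\<Prod>i\<in>UNIV. m i)"
      by (rule prod.reindex_bij_betw[OF bij_Rep_well_ordered])
    finally show ?thesis .
  qed
  ultimately have "det (matrix (reindex \<circ> diag_wrt C m \<circ> unreindex)) = (\<Prod>i\<in>UNIV. m i)"
    by (simp only: mult_1)
  then show "diag_wrt C m ` S \<in> lmeasurable"
    "measure lebesgue (diag_wrt C m ` S) = (\<Prod>i\<in>UNIV. \<bar>m i\<bar>) * measure lebesgue S"
    using measure_linear_image_cart[OF linear_diag_wrt S] by (simp_all add: abs_prod)
qed

text \<open>\<open>K\<close> bounds the distortion of the change of basis and is chosen before
  \<open>m\<close>; this uniformity is what later allows one constant for all times of the
  flow.\<close>

lemma norm_diag_wrt_bound: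
  obtains K where "K > 0" "\<And>m c x. (\<And>i. \<bar>m i\<bar> \<le> c) \<Longrightarrow> norm (diag_wrt C m x) \<le> K * c * norm x"
proof -
  obtain K1 where K1: "K1 > 0" "\<And>x. norm (C x) \<le> K1 * norm x"
    using linear_bounded_pos[OF C(1)] by blast
  obtain K2 where K2: "K2 > 0" "\<And>x. norm (inv C x) \<le> K2 * norm x"
    using linear_bounded_pos[OF linear_inv_bij[OF C]] by blast
  show ?thesis
  proof
    show "0 < K1 * K2" using K1 K2 by simp
    fix m :: "'n \<Rightarrow> real" and c x assume m: "\<And>i. \<bar>m i\<bar> \<le> c"
    have c: "0 \<le> c" using m[of undefined] by linarith
    have "norm (diag_wrt C m x) \<le> K1 * norm (diag_map m (inv C x))"
      by (simp add: diag_wrt_def K1)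
    also have "\<dots> \<le> K1 * (c * norm (inv C x))"
      using K1 m by (intro mult_left_mono norm_diag_map_le) auto
    also have "\<dots> \<le> K1 * (c * (K2 * norm x))"
      using K1 K2 c by (intro mult_left_mono) auto
    finally show "norm (diag_wrt C m x) \<le> K1 * K2 * c * norm x" by (simp add: mult_ac)
  qed
qed

end

subsection \<open>Density along the flow of a diagonalizable map\<close>

text \<open>With \<open>\<alpha> i = ln \<bar>l i\<bar>\<close> this is the real power |A|^s of A =
  \<open>diag_wrt C l\<close>; negative times replace the inverse iterates.\<close>

definition flow :: "(real^'n \<Rightarrow> real^'n) \<Rightarrow> ('n \<Rightarrow> real) \<Rightarrow> real \<Rightarrow> real^'n \<Rightarrow> real^'n" where
  "flow C \<alpha> s = diag_wrt C (\<lambda>i. exp (\<alpha> i * s))"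

text \<open>The factor \<open>exp (s * sum \<alpha> UNIV)\<close> is, up to a constant, the reciprocal of the volume of the flowed ball.\<close>

definition flow_density :: "(real^'n \<Rightarrow> real^'n) \<Rightarrow> ('n \<Rightarrow> real) \<Rightarrow> (real^'n) set \<Rightarrow> bool" where
  "flow_density C \<alpha> E \<longleftrightarrow>
     (\<forall>r>0. ((\<lambda>s. exp (s * sum \<alpha> UNIV) * measure lebesgue (flow C \<alpha> (-s) ` ball 0 r - E)) \<longlongrightarrow> 0) at_top)"

context
  fixes C :: "real^'n \<Rightarrow> real^'n"
  assumes C: "linear C" "bij C"
begin

text \<open>The map with entries m factors as the map with entries k after the one with entries m /
  k, whose norm is at most K * c. It serves both to discard signs and to compare different
  times.\<close>

lemma diag_wrt_ball_subset:
  obtains K where "K > 0"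
    "\<And>m k c r. \<lbrakk>\<And>i. \<bar>m i\<bar> \<le> c * \<bar>k i\<bar>; \<And>i. k i \<noteq> 0; c > 0; r > 0\<rbrakk> \<Longrightarrow>
       diag_wrt C m ` ball 0 r \<subseteq> diag_wrt C k ` ball 0 (K * c * r)"
proof -
  obtain K where K: "K > 0" "\<And>m c x. (\<And>i. \<bar>m i\<bar> \<le> c) \<Longrightarrow> norm (diag_wrt C m x) \<le> K * c * norm x"
    using norm_diag_wrt_bound[OF C] by blast
  show ?thesis
  proof (rule that[OF K(1)])
    fix m k :: "'n \<Rightarrow> real" and c r :: real
    assume mk: "\<And>i. \<bar>m i\<bar> \<le> c * \<bar>k i\<bar>" "\<And>i. k i \<noteq> 0" and r: "r > 0" and c: "c > 0"
    show "diag_wrt C m ` ball 0 r \<subseteq> diag_wrt C k ` ball 0 (K * c * r)"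
    proof
      fix x assume "x \<in> diag_wrt C m ` ball 0 r"
      then obtain y where y: "norm y < r" "x = diag_wrt C m y" by auto
      have "norm (diag_wrt C (\<lambda>i. m i / k i) y) \<le> K * c * norm y"
        using mk by (intro K(2)) (simp add: abs_divide divide_le_eq)
      also have "\<dots> < K * c * r" using y K c by simp
      finally have "diag_wrt C (\<lambda>i. m i / k i) y \<in> ball 0 (K * c * r)" by simp
      moreover have "x = diag_wrt C k (diag_wrt C (\<lambda>i. m i / k i) y)"
        using mk(2) y by (simp add: diag_wrt_diag_wrt[OF C])
      ultimately show "x \<in> diag_wrt C k ` ball 0 (K * c * r)" by blast
    qed
  qed
qed

lemma linear_flow: "linear (flow C \<alpha> s)"
  unfolding flow_def by (rule linear_diag_wrt[OF C])

lemma flow_image: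
  assumes "S \<in> lmeasurable"
  shows lmeasurable_flow_image: "flow C \<alpha> s ` S \<in> lmeasurable"
    and measure_flow_image:
      "measure lebesgue (flow C \<alpha> s ` S) = exp (s * sum \<alpha> UNIV) * measure lebesgue S"
proof -
  show "flow C \<alpha> s ` S \<in> lmeasurable"
    unfolding flow_def by (rule lmeasurable_diag_wrt_image[OF C assms])
  have "(\<Prod>i\<in>UNIV. \<bar>exp (\<alpha> i * s)\<bar>) = exp (s * sum \<alpha> UNIV)"
    by (simp add: exp_sum sum_distrib_left mult.commute)
  then show "measure lebesgue (flow C \<alpha> s ` S) = exp (s * sum \<alpha> UNIV) * measure lebesgue S"
    unfolding flow_def by (simp add: measure_diag_wrt_image[OF C assms])
qed

lemma inv_diag_wrt_funpow:
  assumes "\<And>i. l i \<noteq> 0"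
  shows "inv (diag_wrt C l) ^^ j = diag_wrt C (\<lambda>i. inverse (l i) ^ j)"
proof -
  have inv: "inv (diag_wrt C l) = diag_wrt C (\<lambda>i. inverse (l i))"
    by (rule inv_unique_comp; rule ext)
      (simp_all only: o_apply diag_wrt_diag_wrt[OF C] right_inverse[OF assms] left_inverse[OF assms]
        diag_wrt_one[OF C] id_apply)
  have "(inv (diag_wrt C l) ^^ j) x = diag_wrt C (\<lambda>i. inverse (l i) ^ j) x" for x
    unfolding inv by (induction j) (simp_all add: diag_wrt_diag_wrt[OF C] diag_wrt_one[OF C])
  then show ?thesis by (rule ext)
qed

end

lemma measure_Diff_mono:
  assumes "S \<subseteq> T" "S \<in> fmeasurable M" "T \<in> fmeasurable M" "E \<in> sets M"
  shows "measure M (S - E) \<le> measure M (T - E)"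
  using assms by (intro measure_mono_fmeasurable fmeasurable_Diff) (auto intro: fmeasurableD)

text \<open>The iterated balls \<open>D j r\<close> and the flowed balls contain each other after
  enlarging the radius by a constant, so the missing proportion at one kind of ball controls the
  other. The condition over all radii absorbs the constant.\<close>

lemma density_family_eq_flow_density:
  fixes C :: "real^'n \<Rightarrow> real^'n"
  assumes C: "linear C" "bij C" and l: "\<And>i. 1 < \<bar>l i\<bar>"
  shows "density_family (diag_wrt C l) = {E \<in> sets lebesgue. flow_density C (\<lambda>i. ln \<bar>l i\<bar>) E}"
proof -
  define \<alpha> where "\<alpha> i = ln \<bar>l i\<bar>" for i
  define a where "a = sum \<alpha> UNIV"
  define D where "D j r = (inv (diag_wrt C l) ^^ j) ` ball 0 r" for j r
  define \<beta> where "\<beta> r = measure lebesgue (ball (0 :: real^'n) r)" for r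
  have l0: "l i \<noteq> 0" for i using l[of i] by auto
  have abs_l: "\<bar>l i\<bar> = exp (\<alpha> i)" for i using l[of i] by (simp add: \<alpha>_def)
  have \<alpha>: "\<alpha> i > 0" for i using l[of i] by (simp add: \<alpha>_def)
  have a: "a > 0" unfolding a_def using \<alpha> by (simp add: sum_pos)
  have \<beta>: "\<beta> r > 0" if "r > 0" for r
    using that by (simp add: \<beta>_def content_ball_pos)
  have D_eq: "D j r = diag_wrt C (\<lambda>i. inverse (l i) ^ j) ` ball 0 r" for j r
    unfolding D_def by (subst inv_diag_wrt_funpow[OF C l0]) (rule refl)
  have D_lm [simp, intro]: "D j r \<in> lmeasurable" for j r
    by (simp add: D_eq lmeasurable_diag_wrt_image[OF C])
  have absD: "\<bar>inverse (l i) ^ j\<bar> = exp (- (\<alpha> i * j))" for i j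
    by (simp add: power_abs abs_l exp_minus[symmetric] exp_of_nat_mult[symmetric] mult.commute)
  have D_meas: "measure lebesgue (D j r) = exp (- (j * a)) * \<beta> r" for j r
    unfolding D_eq \<beta>_def
    by (subst measure_diag_wrt_image[OF C])
      (simp_all add: absD a_def exp_sum[symmetric] sum_distrib_left sum_negf mult.commute)
  obtain K where K: "K > 0"
    "\<And>m k c r. \<lbrakk>\<And>i. \<bar>m i\<bar> \<le> c * \<bar>k i\<bar>; \<And>i. k i \<noteq> 0; c > 0; r > 0\<rbrakk> \<Longrightarrow>
       diag_wrt C m ` ball 0 r \<subseteq> diag_wrt C k ` ball 0 (K * c * r)"
    using diag_wrt_ball_subset[OF C] by blast
  \<comment> \<open>At equal times the quotients of the diagonal entries have modulus 1. For a real
    time s with j \<le> s, positive exponents make them at most 1, so c = 1 serves in both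
    inclusions.\<close>
  have D_sub: "D j r \<subseteq> flow C \<alpha> (- real j) ` ball 0 (K * r)" if "r > 0" for j r
    unfolding D_eq flow_def using K(2)[of _ 1] that by (simp add: absD)
  have D_sup: "flow C \<alpha> (- s) ` ball 0 r \<subseteq> D j (K * r)" if "r > 0" "real j \<le> s" for j r s
    unfolding D_eq flow_def using K(2)[of _ 1] that \<alpha> by (simp add: absD l0)
  have flow_lm [simp, intro]: "flow C \<alpha> s ` ball 0 r \<in> lmeasurable" for s r
    by (simp add: lmeasurable_flow_image[OF C])
  have iff: "(emeasure lebesgue E > 0 \<and> (\<forall>r>0. (\<lambda>j. measure lebesgue (E \<inter> D j r) /
                     measure lebesgue (D j r)) \<longlonglongrightarrow> 1)) \<longleftrightarrow> flow_density C \<alpha> E"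
    if E [simp]: "E \<in> sets lebesgue" for E
  proof -
    define q where "q r j = measure lebesgue (D j r - E) / measure lebesgue (D j r)" for r j
    have q: "measure lebesgue (E \<inter> D j r) / measure lebesgue (D j r) = 1 - q r j" if "r > 0" for j r
    proof -
      have "measure lebesgue (D j r) = measure lebesgue (E \<inter> D j r) + measure lebesgue (D j r - E)"
        using measurable_measure_Diff[of "D j r" lebesgue "E \<inter> D j r"]
        by (simp add: sets.Int fmeasurableD Int_commute Diff_Int2 Diff_Int)
      moreover have "measure lebesgue (D j r) > 0" using \<beta>[OF that] by (simp add: D_meas)
      ultimately show ?thesis unfolding q_def
        by (simp add: field_simps)
    qed
    have lim_iff: "(\<lambda>j. measure lebesgue (E \<inter> D j r) / measure lebesgue (D j r)) \<longlonglongrightarrow> 1 \<longleftrightarrow> q r \<longlonglongrightarrow> 0"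
      if "r > 0" for r
      using tendsto_diff[of "\<lambda>_. 1" 1 sequentially "q r" 0] tendsto_diff[of "\<lambda>_. 1" 1 sequentially "\<lambda>j. 1 - q r j" 1]
      by (auto simp: q[OF that])
    have q_ge: "0 \<le> q r j" for r j unfolding q_def by simp
    show ?thesis
    proof
      assume "emeasure lebesgue E > 0 \<and> (\<forall>r>0. (\<lambda>j. measure lebesgue (E \<inter> D j r) / measure lebesgue (D j r)) \<longlonglongrightarrow> 1)"
      then have q0: "q r \<longlonglongrightarrow> 0" if "r > 0" for r using lim_iff that by blast
      show "flow_density C \<alpha> E"
        unfolding flow_density_def a_def[symmetric]
      proof (intro allI impI)
        fix r :: real assume r: "r > 0"
        have "filterlim (\<lambda>s::real. nat \<lfloor>s\<rfloor>) sequentially at_top"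
          by (rule filterlim_compose[OF filterlim_nat_sequentially filterlim_floor_sequentially])
        from filterlim_compose[OF q0 this, of "K * r"]
        have lim: "((\<lambda>s::real. exp a * \<beta> (K * r) * q (K * r) (nat \<lfloor>s\<rfloor>)) \<longlongrightarrow> exp a * \<beta> (K * r) * 0) at_top"
          using r K(1) by (intro tendsto_mult tendsto_const) auto
        show "((\<lambda>s. exp (s * a) * measure lebesgue (flow C \<alpha> (- s) ` ball 0 r - E)) \<longlongrightarrow> 0) at_top"
        proof (rule tendsto_sandwich[OF _ _ tendsto_const lim[simplified]])
          show "\<forall>\<^sub>F s in at_top. exp (s * a) * measure lebesgue (flow C \<alpha> (- s) ` ball 0 r - E)
              \<le> exp a * \<beta> (K * r) * q (K * r) (nat \<lfloor>s\<rfloor>)"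
            using eventually_ge_at_top[of 0]
          proof eventually_elim
            fix s :: real assume s: "0 \<le> s"
            \<comment> \<open>Rounding down gives the inclusion \<open>D_sup\<close>; the rounding
              error of at most 1 costs the volume factor exp a.\<close>
            let ?j = "nat \<lfloor>s\<rfloor>"
            have js: "real ?j \<le> s" "s \<le> real ?j + 1" using s by linarith+
            have "measure lebesgue (flow C \<alpha> (- s) ` ball 0 r - E) \<le> measure lebesgue (D ?j (K * r) - E)"
              using D_sup[OF r js(1)] by (intro measure_Diff_mono) auto
            also have "\<dots> = exp (- (?j * a)) * \<beta> (K * r) * q (K * r) ?j"
              using \<beta>[of "K * r"] K(1) r by (simp add: q_def D_meas)
            finally have "exp (s * a) * measure lebesgue (flow C \<alpha> (- s) ` ball 0 r - E)
              \<le> exp (s * a) * (exp (- (?j * a)) * \<beta> (K * r) * q (K * r) ?j)"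
              by simp
            also have "\<dots> = exp ((s - ?j) * a) * (\<beta> (K * r) * q (K * r) ?j)"
              by (simp add: exp_add[symmetric] algebra_simps exp_diff exp_minus field_simps)
            also have "\<dots> \<le> exp a * (\<beta> (K * r) * q (K * r) ?j)"
            proof (intro mult_right_mono)
              show "exp ((s - ?j) * a) \<le> exp a"
              proof -
                have "(s - ?j) * a \<le> 1 * a" using js a by (intro mult_right_mono) linarith+
                then show ?thesis by (simp only: exp_le_cancel_iff mult_1)
              qed
              show "0 \<le> \<beta> (K * r) * q (K * r) ?j"
                using q_ge \<beta>[of "K * r"] K(1) r by simp
            qed
            finally show "exp (s * a) * measure lebesgue (flow C \<alpha> (- s) ` ball 0 r - E)
              \<le> exp a * \<beta> (K * r) * q (K * r) ?j" by simp
          qed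
        qed simp
      qed
    next
      assume dens: "flow_density C \<alpha> E"
      then have lim: "((\<lambda>s. exp (s * a) * measure lebesgue (flow C \<alpha> (- s) ` ball 0 r - E)) \<longlongrightarrow> 0) at_top"
        if "r > 0" for r using that by (simp add: flow_density_def a_def)
      have "q r \<longlonglongrightarrow> 0" if r: "r > 0" for r
      proof (rule tendsto_sandwich[OF _ _ tendsto_const])
        show "\<forall>\<^sub>F j in sequentially. 0 \<le> q r j" by (simp add: q_ge)
        have "((\<lambda>j. exp (real j * a) * measure lebesgue (flow C \<alpha> (- real j) ` ball 0 (K * r) - E) / \<beta> r) \<longlongrightarrow> 0 / \<beta> r) sequentially"
          using \<beta>[OF r] r K(1) by (intro tendsto_divide tendsto_const filterlim_compose[OF lim filterlim_real_sequentially]) auto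
        then show "((\<lambda>j. exp (real j * a) * measure lebesgue (flow C \<alpha> (- real j) ` ball 0 (K * r) - E) / \<beta> r) \<longlongrightarrow> 0) sequentially" by simp
        show "\<forall>\<^sub>F j in sequentially. q r j \<le> exp (real j * a) * measure lebesgue (flow C \<alpha> (- real j) ` ball 0 (K * r) - E) / \<beta> r"
        proof (rule always_eventually, rule allI)
          fix j
          have "measure lebesgue (D j r - E) \<le> measure lebesgue (flow C \<alpha> (- real j) ` ball 0 (K * r) - E)"
            using D_sub[OF r] by (intro measure_Diff_mono) auto
          then show "q r j \<le> exp (real j * a) * measure lebesgue (flow C \<alpha> (- real j) ` ball 0 (K * r) - E) / \<beta> r"
            using \<beta>[OF r] by (simp add: q_def D_meas exp_minus field_simps)
        qed
      qed
      \<comment> \<open>For a null set E the normalised measure would be the positive constant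
        \<open>\<beta> 1\<close>, contradicting the limit 0.\<close>
      moreover have "emeasure lebesgue E > 0"
      proof (rule ccontr)
        assume "\<not> emeasure lebesgue E > 0"
        then have "E \<in> null_sets lebesgue" by (auto simp: null_sets_def)
        then have "measure lebesgue (flow C \<alpha> (- s) ` ball 0 1 - E) = exp (- (s * a)) * \<beta> 1" for s
          by (subst measure_Diff_null_set) (auto simp: measure_flow_image[OF C] a_def \<beta>_def intro: fmeasurableD)
        then have "((\<lambda>s::real. \<beta> 1) \<longlongrightarrow> 0) at_top"
          using lim[of 1] by (simp only: mult.assoc[symmetric] exp_minus_inverse mult_1 zero_less_one simp_thms)
        then show False using \<beta>[of 1] by (simp add: tendsto_const_iff)
      qed
      ultimately show "emeasure lebesgue E > 0 \<and> (\<forall>r>0. (\<lambda>j. measure lebesgue (E \<inter> D j r) / measure lebesgue (D j r)) \<longlonglongrightarrow> 1)"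
        using lim_iff by blast
    qed
  qed
  then show ?thesis
    unfolding density_family_def D_def \<alpha>_def by blast
qed

subsection \<open>Comparing exponents of two flows\<close>

text \<open>Packing: \<^term>\<open>N\<close> translates of the slab along its normal are disjoint and stay in the ball of radius 2.
  This makes the bound uniform in the direction of the slab.\<close>

lemma measure_slab_le:
  fixes w :: "'a::euclidean_space"
  assumes w: "norm w = 1" and N: "real N * (2 * \<delta>) < 1" "N > 0"
  shows "{z \<in> ball 0 1. \<bar>z \<bullet> w\<bar> \<le> \<delta>} \<in> lmeasurable" (is "?S \<in> _")
    and "real N * measure lebesgue {z \<in> ball 0 1. \<bar>z \<bullet> w\<bar> \<le> \<delta>} \<le> measure lebesgue (ball 0 2 :: 'a set)"
proof -
  have "?S = ball 0 1 \<inter> {z. \<bar>z \<bullet> w\<bar> \<le> \<delta>}" by auto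
  moreover have "closed {z. \<bar>z \<bullet> w\<bar> \<le> \<delta>}"
    by (intro closed_Collect_le continuous_intros)
  ultimately have "?S \<in> sets borel" by simp
  then have "?S \<in> sets lebesgue" by (simp add: sets_completionI_sets)
  moreover have "bounded ?S" by (rule bounded_subset[OF bounded_ball[of 0 1]]) auto
  ultimately show S: "?S \<in> lmeasurable" by (intro bounded_set_imp_lmeasurable)
  \<comment> \<open>Consecutive translates are 1/N apart, more than the slab width 2 * \<delta>, and
    every shift is shorter than 1.\<close>
  define T where "T m = (+) ((real m / real N) *\<^sub>R w) ` ?S" for m
  have T: "T m \<in> lmeasurable" "measure lebesgue (T m) = measure lebesgue ?S" for m
    unfolding T_def using S measurable_translation measure_translation by blast+
  have "disjoint_family_on T {..<N}"
    unfolding disjoint_family_on_def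
  proof (intro ballI impI, rule ccontr)
    fix m m' assume m: "m \<in> {..<N}" "m' \<in> {..<N}" "m \<noteq> m'" and "T m \<inter> T m' \<noteq> {}"
    then obtain x where x: "x \<in> T m" "x \<in> T m'" by blast
    have "\<bar>x \<bullet> w - real m / real N\<bar> \<le> \<delta>" if "x \<in> T m" for m
      using that w by (auto simp: T_def inner_add_left dot_square_norm)
    from this[OF x(1)] this[OF x(2)]
    have "\<bar>real m / real N - real m' / real N\<bar> \<le> 2 * \<delta>" by linarith
    then have "\<bar>real m - real m'\<bar> \<le> real N * (2 * \<delta>)"
      using N(2) by (simp add: diff_divide_distrib[symmetric] divide_le_eq mult.commute)
    then show False using N m(3) by linarith
  qed
  then have "measure lebesgue (\<Union>m<N. T m) = (\<Sum>m<N. measure lebesgue (T m))"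
    using fmeasurableD[OF T(1)] fmeasurableD2[OF T(1)] by (intro measure_finite_Union) auto
  then have "real N * measure lebesgue ?S = measure lebesgue (\<Union>m<N. T m)"
    by (simp add: T(2))
  also have "\<dots> \<le> measure lebesgue (ball 0 2 :: 'a set)"
  proof (intro measure_mono_fmeasurable)
    show "(\<Union>m<N. T m) \<subseteq> ball 0 2"
    proof clarify
      fix x m assume m: "m < N" and "x \<in> T m"
      then obtain z where z: "norm z < 1" "x = (real m / real N) *\<^sub>R w + z"
        by (auto simp: T_def)
      then have "norm x \<le> real m / real N + norm z"
        using w norm_triangle_ineq[of "(real m / real N) *\<^sub>R w" z] by simp
      also have "\<dots> < 1 + 1" using m z by (intro add_less_le_mono) auto
      finally show "x \<in> ball 0 2" by simp
    qed
  qed (use T(1) in \<open>auto intro: fmeasurableD\<close>)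
  finally show "real N * measure lebesgue ?S \<le> measure lebesgue (ball 0 2 :: 'a set)" .
qed

text \<open>The order of choice matters: \<delta> must precede w, because in the application the
  normal depends on a time that is itself chosen in terms of \<delta>.\<close>

lemma thin_slab:
  assumes "\<epsilon> > 0"
  obtains \<delta> where "\<delta> > 0"
    "\<And>w :: 'a::euclidean_space. norm w = 1 \<Longrightarrow> {z \<in> ball 0 1. \<bar>z \<bullet> w\<bar> \<le> \<delta>} \<in> lmeasurable"
    "\<And>w :: 'a::euclidean_space. norm w = 1 \<Longrightarrow>
       measure lebesgue {z \<in> ball 0 1. \<bar>z \<bullet> w\<bar> \<le> \<delta>} \<le> \<epsilon>"
proof -
  obtain n :: nat where n: "measure lebesgue (ball 0 2 :: 'a set) / \<epsilon> < real n"
    using reals_Archimedean2 by blast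
  define N where "N = Suc n"
  have N: "measure lebesgue (ball 0 2 :: 'a set) \<le> real N * \<epsilon>"
    using n assms by (simp add: N_def divide_less_eq algebra_simps)
  define \<delta> where "\<delta> = 1 / (4 * real N)"
  have \<delta>: "\<delta> > 0" "real N * (2 * \<delta>) < 1" "N > 0" by (simp_all add: \<delta>_def N_def)
  show ?thesis
  proof
    fix w :: 'a assume w: "norm w = 1"
    show "{z \<in> ball 0 1. \<bar>z \<bullet> w\<bar> \<le> \<delta>} \<in> lmeasurable"
      by (rule measure_slab_le(1)[OF w \<delta>(2,3)])
    have "real N * measure lebesgue {z \<in> ball 0 1. \<bar>z \<bullet> w\<bar> \<le> \<delta>} \<le> real N * \<epsilon>"
      using measure_slab_le(2)[OF w \<delta>(2,3)] N by linarith
    then show "measure lebesgue {z \<in> ball 0 1. \<bar>z \<bullet> w\<bar> \<le> \<delta>} \<le> \<epsilon>"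
      using \<delta>(3) by simp
  qed (rule \<delta>(1))
qed

text \<open>Between times k and s direction i is scaled by exp (- \<alpha> i * (s - k)), which the
  hypothesis bounds by c. The value c = 1 orders the balls in time up to a constant; other values
  express absorption into a ball of prescribed radius.\<close>

lemma flow_ball_subset:
  fixes C :: "real^'n \<Rightarrow> real^'n"
  assumes C: "linear C" "bij C"
  obtains K where "K > 0"
    "\<And>s k c r. \<lbrakk>\<And>i. - ln c \<le> \<alpha> i * (s - k); c > 0; r > 0\<rbrakk> \<Longrightarrow>
       flow C \<alpha> (- s) ` ball 0 r \<subseteq> flow C \<alpha> (- k) ` ball 0 (K * c * r)"
proof -
  obtain K where K: "K > 0"
    "\<And>m k c r. \<lbrakk>\<And>i. \<bar>m i\<bar> \<le> c * \<bar>k i\<bar>; \<And>i. k i \<noteq> 0; c > 0; r > 0\<rbrakk> \<Longrightarrow>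
       diag_wrt C m ` ball 0 r \<subseteq> diag_wrt C k ` ball 0 (K * c * r)"
    using diag_wrt_ball_subset[OF C] by blast
  show ?thesis
  proof (rule that[OF K(1)])
    fix s k c r :: real assume *: "\<And>i. - ln c \<le> \<alpha> i * (s - k)" and c: "c > 0" and r: "r > 0"
    have "exp (\<alpha> i * - s) \<le> c * exp (\<alpha> i * - k)" for i
    proof -
      have "\<alpha> i * - s \<le> ln c + \<alpha> i * - k" using *[of i] by (simp add: algebra_simps)
      then have "exp (\<alpha> i * - s) \<le> exp (ln c + \<alpha> i * - k)" by (simp only: exp_le_cancel_iff)
      then show ?thesis by (simp only: exp_add exp_ln[OF c])
    qed
    then show "flow C \<alpha> (- s) ` ball 0 r \<subseteq> flow C \<alpha> (- k) ` ball 0 (K * c * r)"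
      unfolding flow_def using c r by (intro K(2)) auto
  qed
qed

lemma flow_column:
  fixes C :: "real^'n \<Rightarrow> real^'n"
  assumes "linear C" "bij C"
  shows "flow C \<alpha> s (C (axis i 1)) = exp (\<alpha> i * s) *\<^sub>R C (axis i 1)"
  by (simp add: flow_def diag_wrt_column[OF assms])

text \<open>If \<open>\<beta> j > \<alpha> i\<close>, the sets \<open>X n\<close> flowing along \<open>C\<close> are eventually long and thin in the
  coordinates that follow the flow along \<open>K\<close>. Removing from \<open>X n\<close> a huge neighbourhood \<open>Y n\<close> of the origin
  in these coordinates keeps at least half of it. The delay \<open>p n\<close> between the two flow times makes
  the remaining pieces summably small compared with every \<open>K\<close>-ball that they can still meet.\<close>

lemma flow_density_exponent_le:
  fixes C K :: "real^'n \<Rightarrow> real^'n"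
  assumes C: "linear C" "bij C" and K: "linear K" "bij K"
    and \<alpha>: "sum \<alpha> UNIV = 1" and \<beta>: "sum \<beta> UNIV = 1" "\<And>i. 0 < \<beta> i"
    and eig: "\<And>s x. flow K \<beta> s x \<bullet> K (axis j 1) = exp (\<beta> j * s) * (x \<bullet> K (axis j 1))"
    and sub: "\<And>E. E \<in> sets lebesgue \<Longrightarrow> flow_density K \<beta> E \<Longrightarrow> flow_density C \<alpha> E"
    and nz: "C (axis i 1) \<bullet> K (axis j 1) \<noteq> 0"
  shows "\<beta> j \<le> \<alpha> i"
proof (rule ccontr)
  assume "\<not> \<beta> j \<le> \<alpha> i"
  then have lt: "\<alpha> i < \<beta> j" by simp
  define u where "u = C (axis i 1)"
  define v where "v = K (axis j 1)"
  define d where "d = \<bar>u \<bullet> v\<bar>"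
  define b where "b = measure lebesgue (ball 0 1 :: (real^'n) set)"
  have uv: "u \<noteq> 0" "v \<noteq> 0" "d > 0" using nz by (auto simp: u_def v_def d_def)
  have b: "b > 0" by (simp add: b_def content_ball_pos)
  have C_lm [simp, intro]: "flow C \<alpha> s ` ball 0 r \<in> lmeasurable" for s r
    by (simp add: lmeasurable_flow_image[OF C])
  have K_lm [simp, intro]: "flow K \<beta> s ` ball 0 r \<in> lmeasurable" for s r
    by (simp add: lmeasurable_flow_image[OF K])
  have C_meas: "measure lebesgue (flow C \<alpha> (- s) ` S) = exp (- s) * measure lebesgue S"
    if "S \<in> lmeasurable" for s S
    using measure_flow_image[OF C that, of \<alpha> "- s"] \<alpha> by simp
  \<comment> \<open>In the coordinates z of the flowed unit ball, pairing with v becomes pairing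
    with \<open>W s\<close>. Testing on the eigenvector u bounds its norm below by the rate
    \<open>\<alpha> i\<close>.\<close>
  define W where "W s = adjoint (flow C \<alpha> (- s)) v" for s
  have W: "flow C \<alpha> (- s) z \<bullet> v = z \<bullet> W s" for s z
    unfolding W_def by (rule adjoint_works[OF linear_flow[OF C], symmetric])
  have W_ge: "exp (\<alpha> i * - s) * d / norm u \<le> norm (W s)" for s
  proof -
    have "exp (\<alpha> i * - s) * d = \<bar>u \<bullet> W s\<bar>"
      unfolding W[symmetric] u_def flow_column[OF C] d_def by (simp add: abs_mult)
    also have "\<dots> \<le> norm u * norm (W s)" by (rule Cauchy_Schwarz_ineq2)
    finally show ?thesis using uv by (simp add: divide_le_eq mult.commute)
  qed

  have thin: "\<exists>s. p \<le> s \<and> measure lebesgue (flow C \<alpha> (- s) ` ball 0 1 \<inter> flow K \<beta> (- (s - p)) ` ball 0 p)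
      \<le> exp (- s) * (b / 2)" if p: "p > 0" for p
  proof -
    obtain \<delta> where \<delta>: "\<delta> > 0"
      "\<And>w :: real^'n. norm w = 1 \<Longrightarrow> {z \<in> ball 0 1. \<bar>z \<bullet> w\<bar> \<le> \<delta>} \<in> lmeasurable"
      "\<And>w :: real^'n. norm w = 1 \<Longrightarrow> measure lebesgue {z \<in> ball 0 1. \<bar>z \<bullet> w\<bar> \<le> \<delta>} \<le> b / 2"
      using thin_slab[of "b / 2"] b by auto
    \<comment> \<open>Dividing the bound for the pairing with v on the K-ball by the lower bound for
      norm (W s) leaves the half-width M * exp (- (\<beta> j - \<alpha> i) * s). The time s is taken
      large enough to bring this below \<delta>, and at least p so that the chosen times tend to
      infinity.\<close>
    define M where "M = p * norm v * exp (\<beta> j * p) * norm u / d"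
    have M: "M > 0" using p uv by (simp add: M_def)
    define s where "s = max p (ln (M / \<delta>) / (\<beta> j - \<alpha> i))"
    have "ln (M / \<delta>) \<le> s * (\<beta> j - \<alpha> i)"
      using lt by (subst pos_divide_le_eq[symmetric]) (simp_all add: s_def)
    then have "exp (ln (M / \<delta>)) \<le> exp (s * (\<beta> j - \<alpha> i))"
      by (simp only: exp_le_cancel_iff)
    then have "M \<le> \<delta> * exp (s * (\<beta> j - \<alpha> i))"
      using M \<delta> by (simp add: divide_le_eq mult.commute)
    then have "M * exp (\<beta> j * - s) \<le> \<delta> * exp (s * (\<beta> j - \<alpha> i)) * exp (\<beta> j * - s)"
      by (intro mult_right_mono) auto
    also have "\<dots> = \<delta> * exp (\<alpha> i * - s)"
      by (simp add: exp_add[symmetric] mult.assoc algebra_simps)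
    finally have s: "p * norm v * exp (\<beta> j * - (s - p)) \<le> \<delta> * (exp (\<alpha> i * - s) * d / norm u)"
      using uv by (simp add: M_def field_simps exp_add exp_diff exp_minus)
    define w where "w = W s /\<^sub>R norm (W s)"
    have Wpos: "norm (W s) > 0"
      using W_ge[of s] uv by (meson divide_pos_pos exp_gt_zero less_le_trans mult_pos_pos zero_less_norm_iff)
    then have w: "norm w = 1" by (simp add: w_def)
    have "flow C \<alpha> (- s) ` ball 0 1 \<inter> flow K \<beta> (- (s - p)) ` ball 0 p
        \<subseteq> flow C \<alpha> (- s) ` {z \<in> ball 0 1. \<bar>z \<bullet> w\<bar> \<le> \<delta>}"
    proof
      fix y assume "y \<in> flow C \<alpha> (- s) ` ball 0 1 \<inter> flow K \<beta> (- (s - p)) ` ball 0 p"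
      then obtain z y' where z: "z \<in> ball 0 1" "y = flow C \<alpha> (- s) z"
        and y': "norm y' < p" "y = flow K \<beta> (- (s - p)) y'" by auto
      have "\<bar>z \<bullet> W s\<bar> = \<bar>y \<bullet> v\<bar>" by (simp add: z(2) W)
      also have "\<dots> = exp (\<beta> j * - (s - p)) * \<bar>y' \<bullet> v\<bar>"
        unfolding y'(2) v_def eig by (simp add: abs_mult)
      also have "\<dots> \<le> exp (\<beta> j * - (s - p)) * (p * norm v)"
        using Cauchy_Schwarz_ineq2[of y' v] y'(1) mult_right_mono[of "norm y'" p "norm v"]
        by (intro mult_left_mono) auto
      also have "\<dots> \<le> \<delta> * (exp (\<alpha> i * - s) * d / norm u)" using s by (simp add: mult_ac)
      also have "\<dots> \<le> \<delta> * norm (W s)" using \<delta>(1) W_ge by (intro mult_left_mono) auto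
      finally have "\<bar>z \<bullet> w\<bar> \<le> \<delta>"
        using Wpos by (simp add: w_def abs_mult divide_simps mult.commute)
      then show "y \<in> flow C \<alpha> (- s) ` {z \<in> ball 0 1. \<bar>z \<bullet> w\<bar> \<le> \<delta>}" using z by blast
    qed
    then have "measure lebesgue (flow C \<alpha> (- s) ` ball 0 1 \<inter> flow K \<beta> (- (s - p)) ` ball 0 p)
        \<le> measure lebesgue (flow C \<alpha> (- s) ` {z \<in> ball 0 1. \<bar>z \<bullet> w\<bar> \<le> \<delta>})"
      by (intro measure_mono_fmeasurable lmeasurable_flow_image[OF C] \<delta>(2)[OF w])
        (auto intro!: sets.Int fmeasurableD)
    also have "\<dots> \<le> exp (- s) * (b / 2)"
      by (simp only: C_meas[OF \<delta>(2)[OF w]]) (intro mult_left_mono \<delta>(3)[OF w], simp)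
    finally show ?thesis by (intro exI[of _ s]) (simp add: s_def)
  qed
  \<comment> \<open>\<open>p n\<close> is at once the delay, the radius of \<open>Y n\<close> and a
    lower bound for \<open>s n\<close>. It must tend to infinity and have summable exp (- p
    n).\<close>
  define p where "p n = real (Suc n)" for n
  have p: "p n > 0" for n by (simp add: p_def)
  from thin[OF p] obtain s where s_ge: "\<And>n. p n \<le> s n"
    and s: "\<And>n. measure lebesgue (flow C \<alpha> (- s n) ` ball 0 1 \<inter> flow K \<beta> (- (s n - p n)) ` ball 0 (p n))
      \<le> exp (- s n) * (b / 2)"
    by metis
  define X where "X n = flow C \<alpha> (- s n) ` ball 0 1" for n
  define Y where "Y n = flow K \<beta> (- (s n - p n)) ` ball 0 (p n)" for n
  define F where "F = (\<Union>n. X n - Y n)"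
  have X_lm: "X n \<in> lmeasurable" and Y_lm: "Y n \<in> lmeasurable" for n by (simp_all add: X_def Y_def)
  have X_meas: "measure lebesgue (X n) = exp (- s n) * b" for n
    by (simp add: X_def C_meas b_def)
  have F: "F \<in> sets lebesgue"
    unfolding F_def using X_lm Y_lm by (intro sets.countable_UN' sets.Diff) (auto intro: fmeasurableD)

  \<comment> \<open>At time t, each of finitely many pieces is eventually missed because
    \<open>Y n\<close> swallows the ball. A later piece with s n - p n \<le> t is missed because the
    radius \<open>p n\<close> is large. Any other piece has volume at most exp (- t) * exp (- p n) *
    b, and these sum to a small multiple of exp (- t).\<close>
  have "flow_density K \<beta> (- F)"
    unfolding flow_density_def
  proof (intro allI impI)
    fix r :: real assume r: "r > 0"
    obtain L where L: "L > 0"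
      "\<And>s k c r. \<lbrakk>\<And>i. - ln c \<le> \<beta> i * (s - k); c > 0; r > 0\<rbrakk> \<Longrightarrow>
       flow K \<beta> (- s) ` ball 0 r \<subseteq> flow K \<beta> (- k) ` ball 0 (L * c * r)"
      using flow_ball_subset[OF K] by blast
    have absorb: "\<forall>\<^sub>F t in at_top. flow K \<beta> (- t) ` ball 0 r \<subseteq> Y n" for n
    proof -
      define c where "c = p n / (L * r)"
      have c: "c > 0" "L * c * r = p n" using p[of n] L(1) r by (simp_all add: c_def)
      \<comment> \<open>The slowest contraction rate: after waiting - ln c / \<mu>, every direction
        has shrunk by the factor c.\<close>
      define \<mu> where "\<mu> = Min (range \<beta>)"
      have \<mu>: "\<mu> > 0" "\<mu> \<le> \<beta> i" for i using \<beta>(2) by (simp_all add: \<mu>_def)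
      show ?thesis
        using eventually_ge_at_top[of "s n - p n + max 0 (- ln c / \<mu>)"]
      proof eventually_elim
        fix t assume t: "s n - p n + max 0 (- ln c / \<mu>) \<le> t"
        have "- ln c \<le> \<beta> i' * (t - (s n - p n))" for i'
        proof -
          have "- ln c = \<mu> * (- ln c / \<mu>)" using \<mu>(1) by simp
          also have "\<dots> \<le> \<beta> i' * (t - (s n - p n))"
          proof -
            have "\<mu> * (- ln c / \<mu>) \<le> \<mu> * (t - (s n - p n))"
              using t \<mu>(1) by (intro mult_left_mono) linarith+
            also have "\<dots> \<le> \<beta> i' * (t - (s n - p n))"
              using t \<mu>(2)[of i'] by (intro mult_right_mono) linarith+
            finally show ?thesis .
          qed
          finally show ?thesis .
        qed
        from L(2)[OF this c(1) r] show "flow K \<beta> (- t) ` ball 0 r \<subseteq> Y n"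
          unfolding Y_def c(2) .
      qed
    qed
    show "((\<lambda>t. exp (t * sum \<beta> UNIV) * measure lebesgue (flow K \<beta> (- t) ` ball 0 r - - F)) \<longlongrightarrow> 0) at_top"
    proof (rule tendstoI)
      fix \<epsilon> :: real assume \<epsilon>: "\<epsilon> > 0"
      have "exp (- p n) = exp (- 1) * exp (- 1) ^ n" for n
        by (simp add: p_def exp_of_nat_mult[symmetric] exp_add[symmetric])
      moreover have "summable (\<lambda>n. exp (- 1 :: real) * exp (- 1) ^ n)"
        by (intro summable_mult summable_geometric) simp
      ultimately have sm: "summable (\<lambda>n. exp (- p n))" by simp
      then obtain N1 where N1: "\<And>n. n \<ge> N1 \<Longrightarrow> norm (\<Sum>i. exp (- p (i + n))) < \<epsilon> / b"
        using suminf_exist_split[of "\<epsilon> / b" "\<lambda>n. exp (- p n)"] \<epsilon> b by auto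
      obtain N2 :: nat where N2: "L * r < real N2" using reals_Archimedean2 by blast
      \<comment> \<open>\<open>N1\<close> makes the geometric tail small; \<open>N2\<close> makes
        the radii \<open>p n\<close> at least L * r.\<close>
      define N where "N = max N1 N2"
      have tail: "(\<Sum>i. exp (- p (i + N))) * b < \<epsilon>"
      proof -
        have "(\<Sum>i. exp (- p (i + N))) < \<epsilon> / b"
          using N1[of N] by (simp add: N_def abs_less_iff)
        then show ?thesis using b by (simp add: less_divide_eq)
      qed
      have p_ge: "L * r \<le> p n" if "n \<ge> N" for n using N2 that by (simp add: N_def p_def)
      have "\<forall>\<^sub>F t in at_top. \<forall>n\<in>{..<N}. flow K \<beta> (- t) ` ball 0 r \<subseteq> Y n"
        by (intro eventually_ball_finite ballI absorb) simp
      then show "\<forall>\<^sub>F t in at_top. dist (exp (t * sum \<beta> UNIV) * measure lebesgue (flow K \<beta> (- t) ` ball 0 r - - F)) 0 < \<epsilon>"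
      proof eventually_elim
        fix t assume t: "\<forall>n\<in>{..<N}. flow K \<beta> (- t) ` ball 0 r \<subseteq> Y n"
        \<comment> \<open>Only the pieces the t-ball can still meet are kept, shifted by N; the rest
          become empty so that one series bounds the union.\<close>
        define Z where "Z i = (if s (i + N) - p (i + N) > t then X (i + N) else {})" for i
        have Z_lm: "Z i \<in> lmeasurable" for i using X_lm by (simp add: Z_def)
        have Z_meas: "measure lebesgue (Z i) \<le> exp (- t) * b * exp (- p (i + N))" for i
        proof (cases "s (i + N) - p (i + N) > t")
          case True
          then have "exp (- s (i + N)) \<le> exp (- t + - p (i + N))" by simp
          then have "exp (- s (i + N)) * b \<le> exp (- t) * exp (- p (i + N)) * b"
            using b by (intro mult_right_mono) (simp_all only: exp_add less_imp_le)
          then show ?thesis using True by (simp add: Z_def X_meas mult_ac)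
        next
          case False
          then show ?thesis using b by (simp add: Z_def)
        qed
        have Z_UN: "(\<Union>i. Z i) \<in> lmeasurable" "measure lebesgue (\<Union>i. Z i) \<le> exp (- t) * b * (\<Sum>i. exp (- p (i + N)))"
        proof -
          have fin: "measure lebesgue (\<Union>i\<le>n. Z i) \<le> exp (- t) * b * (\<Sum>i. exp (- p (i + N)))" for n
          proof -
            have "measure lebesgue (\<Union>i\<le>n. Z i) \<le> (\<Sum>i\<le>n. measure lebesgue (Z i))"
              using Z_lm by (intro measure_UNION_le) (auto intro: fmeasurableD)
            also have "\<dots> \<le> (\<Sum>i\<le>n. exp (- t) * b * exp (- p (i + N)))"
              by (intro sum_mono Z_meas)
            also have "\<dots> = exp (- t) * b * (\<Sum>i\<le>n. exp (- p (i + N)))"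
              by (simp add: sum_distrib_left)
            also have "\<dots> \<le> exp (- t) * b * (\<Sum>i. exp (- p (i + N)))"
              using b sm by (intro mult_left_mono sum_le_suminf) (auto simp: summable_iff_shift[of "\<lambda>n. exp (- p n)"])
            finally show ?thesis .
          qed
          show "(\<Union>i. Z i) \<in> lmeasurable" "measure lebesgue (\<Union>i. Z i) \<le> exp (- t) * b * (\<Sum>i. exp (- p (i + N)))"
            using fmeasurable_countable_Union[of Z, OF Z_lm fin] measure_countable_Union_le[of Z, OF Z_lm fin] by simp_all
        qed
        have "flow K \<beta> (- t) ` ball 0 r - - F \<subseteq> (\<Union>i. Z i)"
        proof
          fix x assume "x \<in> flow K \<beta> (- t) ` ball 0 r - - F"
          then obtain n where x: "x \<in> flow K \<beta> (- t) ` ball 0 r" and n: "x \<in> X n" "x \<notin> Y n"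
            by (auto simp: F_def)
          have "n \<ge> N" using t x n by (meson lessThan_iff not_less subsetD)
          moreover have "s n - p n > t"
          proof (rule ccontr)
            assume "\<not> s n - p n > t"
            then have "flow K \<beta> (- t) ` ball 0 r \<subseteq> flow K \<beta> (- (s n - p n)) ` ball 0 (L * 1 * r)"
              using \<beta>(2) r by (intro L(2)) (auto simp: less_imp_le)
            also have "\<dots> \<subseteq> Y n" unfolding Y_def using p_ge[OF \<open>n \<ge> N\<close>] by (intro image_mono) auto
            finally show False using x n by blast
          qed
          ultimately have "x \<in> Z (n - N)" using n by (simp add: Z_def)
          then show "x \<in> (\<Union>i. Z i)" by blast
        qed
        then have "measure lebesgue (flow K \<beta> (- t) ` ball 0 r - - F) \<le> measure lebesgue (\<Union>i. Z i)"
          using F by (intro measure_mono_fmeasurable Z_UN(1) sets.Diff) (auto intro: fmeasurableD sets.compl_sets simp: Compl_eq_Diff_UNIV)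
        also note Z_UN(2)
        finally have "exp t * measure lebesgue (flow K \<beta> (- t) ` ball 0 r - - F) \<le> exp t * (exp (- t) * b * (\<Sum>i. exp (- p (i + N))))"
          by simp
        also have "\<dots> = (\<Sum>i. exp (- p (i + N))) * b" by (simp add: exp_minus)
        finally show "dist (exp (t * sum \<beta> UNIV) * measure lebesgue (flow K \<beta> (- t) ` ball 0 r - - F)) 0 < \<epsilon>"
          using tail \<beta>(1) by (simp add: dist_real_def)
      qed
    qed
  qed
  moreover have "- F \<in> sets lebesgue" using F by (simp add: Compl_in_sets_lebesgue)
  ultimately have "flow_density C \<alpha> (- F)" using sub by blast
  then have "((\<lambda>t. exp t * measure lebesgue (flow C \<alpha> (- t) ` ball 0 1 - - F)) \<longlongrightarrow> 0) at_top"
    unfolding flow_density_def \<alpha> by simp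
  moreover have "filterlim s at_top sequentially"
  proof (rule filterlim_at_top_mono)
    show "filterlim p at_top sequentially"
      unfolding p_def by (intro filterlim_compose[OF filterlim_real_sequentially filterlim_Suc])
  qed (simp add: s_ge)
  ultimately have lim: "(\<lambda>n. exp (s n) * measure lebesgue (X n - - F)) \<longlonglongrightarrow> 0"
    unfolding X_def by (rule filterlim_compose)
  \<comment> \<open>At time \<open>s n\<close> the C-flowed unit ball is \<open>X n\<close> itself,
    and \<open>F\<close> contains at least half of it, so the limit cannot be 0.\<close>
  have "b / 2 \<le> exp (s n) * measure lebesgue (X n - - F)" for n
  proof -
    have "X n - Y n = X n - X n \<inter> Y n" by blast
    then have "measure lebesgue (X n - Y n) = measure lebesgue (X n) - measure lebesgue (X n \<inter> Y n)"
      using X_lm Y_lm by (metis Int_lower1 fmeasurable.Int fmeasurableD measurable_measure_Diff)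
    then have "exp (- s n) * (b / 2) \<le> measure lebesgue (X n - Y n)"
      using s[of n, folded X_def Y_def] unfolding X_meas by linarith
    also have "\<dots> \<le> measure lebesgue (X n - - F)"
    proof (intro measure_mono_fmeasurable fmeasurable_Diff X_lm)
      show "X n - Y n \<subseteq> X n - - F" by (auto simp: F_def)
      show "X n - Y n \<in> sets lebesgue" using X_lm Y_lm by (intro sets.Diff fmeasurableD)
      show "- F \<in> sets lebesgue" using F by (simp add: Compl_in_sets_lebesgue)
    qed
    finally have "exp (s n) * (exp (- s n) * (b / 2)) \<le> exp (s n) * measure lebesgue (X n - - F)"
      by simp
    then show ?thesis unfolding mult.assoc[symmetric] exp_minus_inverse by simp
  qed
  then have "b / 2 \<le> 0" by (intro LIMSEQ_le_const[OF lim]) auto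
  then show False using b by simp
qed

subsection \<open>Equality of density families\<close>

lemma flow_scale: "flow C (\<lambda>i. c * \<alpha> i) s = flow C \<alpha> (c * s)"
  by (simp add: flow_def mult_ac)

text \<open>Scaling all exponents by c only reparametrises time, and the volume factor follows. It
  is what permits both the normalisation to sum 1 and the passage to |A|^t.\<close>

lemma flow_density_scale:
  assumes "c > 0"
  shows "flow_density C (\<lambda>i. c * \<alpha> i) E \<longleftrightarrow> flow_density C \<alpha> E"
proof -
  have "((\<lambda>s. f (c * s)) \<longlongrightarrow> 0) at_top \<longleftrightarrow> (f \<longlongrightarrow> 0) at_top" for f :: "real \<Rightarrow> real"
  proof
    assume *: "((\<lambda>s. f (c * s)) \<longlongrightarrow> 0) at_top"
    have "filterlim (\<lambda>s. (1 / c) * s) at_top at_top"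
      using assms by (intro filterlim_tendsto_pos_mult_at_top[OF tendsto_const _ filterlim_ident]) simp
    from filterlim_compose[OF * this] show "(f \<longlongrightarrow> 0) at_top" using assms by simp
  next
    assume *: "(f \<longlongrightarrow> 0) at_top"
    have "filterlim (\<lambda>s. c * s) at_top at_top"
      using assms by (intro filterlim_tendsto_pos_mult_at_top[OF tendsto_const _ filterlim_ident])
    from filterlim_compose[OF * this] show "((\<lambda>s. f (c * s)) \<longlongrightarrow> 0) at_top" .
  qed
  from this[of "\<lambda>s. exp (s * sum \<alpha> UNIV) * measure lebesgue (flow C \<alpha> (- s) ` ball 0 _ - E)"]
  show ?thesis
    unfolding flow_density_def flow_scale by (simp add: sum_distrib_left[symmetric] mult_ac)
qed

section \<open>Eigenvalues and self-adjointness of maps given by a basis of eigenvectors\<close>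

lemma expansive_eigenvalue:
  fixes C :: "real^'n \<Rightarrow> real^'n"
  assumes C: "linear C" "bij C" and "expansive (diag_wrt C l)"
  shows "1 < \<bar>l i\<bar>"
proof -
  define x where "x = C (axis i 1)"
  define v :: "complex^'n" where "v = (\<chi> k. complex_of_real (x $ k))"
  have "inj C" using C(2) by (rule bij_is_inj)
  then have "x \<noteq> 0"
    unfolding x_def using linear_injective_0[OF C(1)] by (metis axis_eq_0_iff zero_neq_one)
  then have "v \<noteq> 0" by (auto simp: v_def vec_eq_iff)
  \<comment> \<open>The column of \<open>C\<close>, read as a complex vector, is an eigenvector for
    \<open>l i\<close>.\<close>
  moreover have "map_matrix complex_of_real (matrix (diag_wrt C l)) *v v = complex_of_real (l i) *s v"
  proof -
    have "matrix (diag_wrt C l) *v x = l i *\<^sub>R x"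
      by (simp add: x_def matrix_vector_mul(2)[OF linear_diag_wrt[OF C]] diag_wrt_column[OF C])
    then have "(\<Sum>k\<in>UNIV. matrix (diag_wrt C l) $ m $ k * x $ k) = l i * x $ m" for m
      by (simp add: matrix_vector_mult_def vec_eq_iff)
    then have "(\<Sum>k\<in>UNIV. complex_of_real (matrix (diag_wrt C l) $ m $ k) * complex_of_real (x $ k))
        = complex_of_real (l i) * complex_of_real (x $ m)" for m
      by (metis (mono_tags, lifting) of_real_mult of_real_sum sum.cong)
    then show ?thesis
      by (simp add: v_def map_matrix_def matrix_vector_mult_def vec_eq_iff)
  qed
  ultimately have "complex_eigenvalue (diag_wrt C l) (complex_of_real (l i))"
    unfolding complex_eigenvalue_def by blast
  then show ?thesis
    using assms(3) unfolding expansive_def by fastforce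
qed

text \<open>Columns with different \<open>l\<close> are orthogonal, and columns with equal
  \<open>l\<close> have equal \<open>m\<close>, so on every pair of columns either factor may be
  used. This covers |l| and all times of the flow, whose entries are functions of |l|.\<close>

lemma diag_wrt_inner_column:
  fixes C :: "real^'n \<Rightarrow> real^'n"
  assumes C: "linear C" "bij C" and sa: "adjoint (diag_wrt C l) = diag_wrt C l"
    and m: "\<And>i j. l i = l j \<Longrightarrow> m i = m j"
  shows "diag_wrt C m x \<bullet> C (axis j 1) = m j * (x \<bullet> C (axis j 1))"
proof -
  have col: "m i * (C (axis i 1) \<bullet> C (axis j 1)) = m j * (C (axis i 1) \<bullet> C (axis j 1))" for i
  proof -
    have "diag_wrt C l (C (axis i 1)) \<bullet> C (axis j 1) = C (axis i 1) \<bullet> diag_wrt C l (C (axis j 1))"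
      using adjoint_works[OF linear_diag_wrt[OF C], of "C (axis i 1)" l "C (axis j 1)"] by (simp add: sa)
    then have "l i * (C (axis i 1) \<bullet> C (axis j 1)) = l j * (C (axis i 1) \<bullet> C (axis j 1))"
      by (simp add: diag_wrt_column[OF C])
    then show ?thesis using m[of i j] by auto
  qed
  define f where "f y = diag_wrt C m (C y) \<bullet> C (axis j 1)" for y
  define g where "g y = m j * (C y \<bullet> C (axis j 1))" for y
  have "f = g"
  proof (rule linear_eq_stdbasis)
    show "linear f"
      unfolding f_def by (rule linearI)
        (simp_all add: linear_add[OF linear_diag_wrt[OF C]] linear_cmul[OF linear_diag_wrt[OF C]]
          linear_add[OF C(1)] linear_cmul[OF C(1)] inner_add_left)
    show "linear g"
      unfolding g_def by (rule linearI)
        (simp_all add: linear_add[OF C(1)] linear_cmul[OF C(1)] inner_add_left distrib_left)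
    fix e :: "real^'n" assume "e \<in> Basis"
    then obtain i where "e = axis i 1" by (auto simp: Basis_vec_def)
    then show "f e = g e" by (simp add: f_def g_def diag_wrt_column[OF C] col)
  qed
  then have "f (inv C x) = g (inv C x)" by simp
  then show ?thesis by (simp add: f_def g_def inv_bij_cancel[OF C])
qed

text \<open>A column of \<open>K\<close> has some nonzero coordinate k in the basis of
  \<open>C\<close>; the map multiplies that coordinate by \<open>l k\<close> and also by
  \<open>m j\<close>.\<close>

lemma diag_wrt_eigenvalues_subset:
  fixes C K :: "real^'n \<Rightarrow> real^'n"
  assumes C: "linear C" "bij C" and K: "linear K" "bij K" and eq: "diag_wrt C l = diag_wrt K m"
  shows "range m \<subseteq> range l"
proof clarify
  fix j
  define z where "z = inv C (K (axis j 1))"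
  have "inv C (diag_wrt C l (K (axis j 1))) = inv C (m j *\<^sub>R K (axis j 1))"
    unfolding eq by (simp add: diag_wrt_column[OF K])
  then have "diag_map l z = m j *\<^sub>R z"
    by (simp add: diag_wrt_def z_def inv_bij_cancel[OF C] linear_cmul[OF linear_inv_bij[OF C]])
  moreover have "z \<noteq> 0"
  proof
    assume "z = 0"
    then have "K (axis j 1) = K 0"
      using inv_bij_cancel(2)[OF C, of "K (axis j 1)"] linear_0[OF C(1)] linear_0[OF K(1)] by (simp add: z_def)
    then show False using K(2) by (metis axis_eq_0_iff bij_is_inj injD zero_neq_one)
  qed
  then obtain k where "z $ k \<noteq> 0" by (auto simp: vec_eq_iff)
  ultimately show "m j \<in> range l" by (simp add: diag_map_def vec_eq_iff) (metis rangeI)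
qed

lemma linear_powr_diag_wrt:
  fixes C :: "real^'n \<Rightarrow> real^'n"
  assumes "linear C" "bij C" "\<And>i. 0 < l i"
  shows "linear_powr (diag_wrt C l) t = diag_wrt C (\<lambda>i. l i powr t)"
  unfolding diag_wrt_def using assms by (intro linear_powr_eq) auto

text \<open>Both maps are tested on columns of \<open>C\<close> against columns of \<open>K\<close>:
  a pairing contributes l i on one side and m j on the other, equal unless the pairing vanishes.
  Since the columns of \<open>K\<close> span, this determines the images.\<close>

lemma diag_wrt_eqI:
  fixes C K :: "real^'n \<Rightarrow> real^'n"
  assumes C: "linear C" "bij C" and K: "linear K" "bij K"
    and eig: "\<And>x j. diag_wrt K m x \<bullet> K (axis j 1) = m j * (x \<bullet> K (axis j 1))"
    and eq: "\<And>i j. C (axis i 1) \<bullet> K (axis j 1) \<noteq> 0 \<Longrightarrow> l i = m j"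
  shows "diag_wrt C l = diag_wrt K m"
proof -
  have "diag_wrt C l (C (axis i 1)) = diag_wrt K m (C (axis i 1))" for i
  proof -
    define y where "y = diag_wrt C l (C (axis i 1)) - diag_wrt K m (C (axis i 1))"
    have y: "y \<bullet> K (axis j 1) = 0" for j
      using eq[of i j] by (auto simp: y_def inner_diff_left eig diag_wrt_column[OF C])
    have "(\<lambda>x. y \<bullet> K x) = (\<lambda>x. 0)"
    proof (rule linear_eq_stdbasis)
      show "linear (\<lambda>x. y \<bullet> K x)"
        by (rule linearI) (simp_all add: linear_add[OF K(1)] linear_cmul[OF K(1)] inner_add_right)
      show "linear (\<lambda>x::real^'n. 0 :: real)" by (rule linearI) simp_all
      fix e :: "real^'n" assume "e \<in> Basis"
      then show "y \<bullet> K e = 0" using y by (auto simp: Basis_vec_def)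
    qed
    from fun_cong[OF this, of "inv K y"] have "y = 0" by (simp add: inv_bij_cancel[OF K])
    then show ?thesis by (simp add: y_def)
  qed
  then have "diag_wrt C l \<circ> C = diag_wrt K m \<circ> C"
    by (intro linear_eq_stdbasis linear_compose linear_diag_wrt C K) (auto simp: Basis_vec_def)
  then show ?thesis
    by (metis (no_types, lifting) C comp_apply ext inv_bij_cancel(2))
qed

lemma density_family_eq_iff:
  fixes C1 C2 :: "real^'n \<Rightarrow> real^'n"
  assumes C1: "linear C1" "bij C1" and C2: "linear C2" "bij C2"
    and l1: "\<And>i. 1 < \<bar>l1 i\<bar>" and l2: "\<And>i. 1 < \<bar>l2 i\<bar>"
    and sa1: "adjoint (diag_wrt C1 l1) = diag_wrt C1 l1"
    and sa2: "adjoint (diag_wrt C2 l2) = diag_wrt C2 l2"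
  shows "density_family (diag_wrt C1 l1) = density_family (diag_wrt C2 l2) \<longleftrightarrow>
    (\<exists>t>0. linear_powr (diag_wrt C1 (\<lambda>i. \<bar>l1 i\<bar>)) t = diag_wrt C2 (\<lambda>i. \<bar>l2 i\<bar>))"
proof
  define \<alpha> where "\<alpha> i = ln \<bar>l1 i\<bar>" for i
  define \<beta> where "\<beta> i = ln \<bar>l2 i\<bar>" for i
  define a where "a = sum \<alpha> UNIV"
  define b where "b = sum \<beta> UNIV"
  have pos: "\<alpha> i > 0" "\<beta> i > 0" for i
    unfolding \<alpha>_def \<beta>_def by (rule ln_gt_zero[OF l1] ln_gt_zero[OF l2])+
  then have ab: "a > 0" "b > 0" unfolding a_def b_def by (simp_all add: sum_pos)
  have abs_l: "\<bar>l1 i\<bar> = exp (\<alpha> i)" "\<bar>l2 i\<bar> = exp (\<beta> i)" for i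
    using l1[of i] l2[of i] by (simp_all add: \<alpha>_def \<beta>_def)
  assume "density_family (diag_wrt C1 l1) = density_family (diag_wrt C2 l2)"
  then have "flow_density C1 \<alpha> E \<longleftrightarrow> flow_density C2 \<beta> E" if "E \<in> sets lebesgue" for E
    using that unfolding density_family_eq_flow_density[OF C1 l1] density_family_eq_flow_density[OF C2 l2]
      \<alpha>_def \<beta>_def by blast
  then have dens: "flow_density C1 (\<lambda>i. (1 / a) * \<alpha> i) E \<longleftrightarrow> flow_density C2 (\<lambda>i. (1 / b) * \<beta> i) E"
    if "E \<in> sets lebesgue" for E
    using that ab flow_density_scale[of "1 / a" C1 \<alpha> E] flow_density_scale[of "1 / b" C2 \<beta> E] by simp
  have norm1: "(\<Sum>i\<in>UNIV. (1 / a) * \<alpha> i) = 1" "(\<Sum>i\<in>UNIV. (1 / b) * \<beta> i) = 1"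
    using ab by (simp_all add: sum_divide_distrib[symmetric] a_def[symmetric] b_def[symmetric])
  have eig1: "flow C1 (\<lambda>i. (1 / a) * \<alpha> i) s x \<bullet> C1 (axis j 1) = exp ((1 / a) * \<alpha> j * s) * (x \<bullet> C1 (axis j 1))" for s x j
    unfolding flow_def by (rule diag_wrt_inner_column[OF C1 sa1]) (simp add: \<alpha>_def)
  have eig2: "flow C2 (\<lambda>i. (1 / b) * \<beta> i) s x \<bullet> C2 (axis j 1) = exp ((1 / b) * \<beta> j * s) * (x \<bullet> C2 (axis j 1))" for s x j
    unfolding flow_def by (rule diag_wrt_inner_column[OF C2 sa2]) (simp add: \<beta>_def)
  have match: "\<alpha> i * (b / a) = \<beta> j" if nz: "C1 (axis i 1) \<bullet> C2 (axis j 1) \<noteq> 0" for i j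
  proof -
    have "(1 / b) * \<beta> j \<le> (1 / a) * \<alpha> i"
      by (rule flow_density_exponent_le[OF C1 C2 norm1(1,2) _ eig2 _ nz]) (use pos ab dens in auto)
    moreover have "(1 / a) * \<alpha> i \<le> (1 / b) * \<beta> j"
      by (rule flow_density_exponent_le[OF C2 C1 norm1(2,1) _ eig1])
        (use pos ab dens nz in \<open>auto simp: inner_commute\<close>)
    ultimately show ?thesis using ab by (simp add: field_simps)
  qed
  \<comment> \<open>The exponent b / a undoes the two normalisations.\<close>
  have "diag_wrt C1 (\<lambda>i. \<bar>l1 i\<bar> powr (b / a)) = diag_wrt C2 (\<lambda>i. \<bar>l2 i\<bar>)"
  proof (rule diag_wrt_eqI[OF C1 C2])
    show "diag_wrt C2 (\<lambda>i. \<bar>l2 i\<bar>) x \<bullet> C2 (axis j 1) = \<bar>l2 j\<bar> * (x \<bullet> C2 (axis j 1))" for x j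
      by (rule diag_wrt_inner_column[OF C2 sa2]) simp
    show "\<bar>l1 i\<bar> powr (b / a) = \<bar>l2 j\<bar>" if "C1 (axis i 1) \<bullet> C2 (axis j 1) \<noteq> 0" for i j
      using match[OF that] by (simp add: abs_l powr_def mult.commute)
  qed
  then show "\<exists>t>0. linear_powr (diag_wrt C1 (\<lambda>i. \<bar>l1 i\<bar>)) t = diag_wrt C2 (\<lambda>i. \<bar>l2 i\<bar>)"
    using ab l1 by (intro exI[of _ "b / a"] conjI) (auto simp: linear_powr_diag_wrt[OF C1] abs_l)
next
  assume "\<exists>t>0. linear_powr (diag_wrt C1 (\<lambda>i. \<bar>l1 i\<bar>)) t = diag_wrt C2 (\<lambda>i. \<bar>l2 i\<bar>)"
  then obtain t where t: "t > 0" "linear_powr (diag_wrt C1 (\<lambda>i. \<bar>l1 i\<bar>)) t = diag_wrt C2 (\<lambda>i. \<bar>l2 i\<bar>)"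
    by blast
  have l0: "l1 i \<noteq> 0" "l2 i \<noteq> 0" for i using l1[of i] l2[of i] by auto
  have eq: "diag_wrt C1 (\<lambda>i. \<bar>l1 i\<bar> powr t) = diag_wrt C2 (\<lambda>i. \<bar>l2 i\<bar>)"
    using t(2) l0 by (simp add: linear_powr_diag_wrt[OF C1])
  \<comment> \<open>Taking the real power s of the equality in \<open>eq\<close> extends it to the
    whole flow.\<close>
  have flow_eq: "flow C1 (\<lambda>i. t * ln \<bar>l1 i\<bar>) s = flow C2 (\<lambda>i. ln \<bar>l2 i\<bar>) s" for s
  proof -
    have "diag_wrt C1 (\<lambda>i. (\<bar>l1 i\<bar> powr t) powr s) = diag_wrt C2 (\<lambda>i. \<bar>l2 i\<bar> powr s)"
      using arg_cong[OF eq, of "\<lambda>A. linear_powr A s"] l0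
      by (simp add: linear_powr_diag_wrt[OF C1] linear_powr_diag_wrt[OF C2])
    then show ?thesis
      using l0 by (simp add: flow_def powr_def mult_ac)
  qed
  \<comment> \<open>The eigenvalues may be listed in different orders, so the sums are compared
    through the volume of a flowed ball.\<close>
  have sum_eq: "sum (\<lambda>i. t * ln \<bar>l1 i\<bar>) UNIV = sum (\<lambda>i. ln \<bar>l2 i\<bar>) UNIV"
  proof -
    have "measure lebesgue (flow C1 (\<lambda>i. t * ln \<bar>l1 i\<bar>) 1 ` ball 0 1) = measure lebesgue (flow C2 (\<lambda>i. ln \<bar>l2 i\<bar>) 1 ` ball 0 1)"
      by (simp only: flow_eq)
    then show ?thesis
      using content_ball_pos[of 1 "0 :: real^'n"]
      by (simp only: measure_flow_image[OF C1 lmeasurable_ball] measure_flow_image[OF C2 lmeasurable_ball]) simp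
  qed
  have "flow_density C1 (\<lambda>i. ln \<bar>l1 i\<bar>) E \<longleftrightarrow> flow_density C2 (\<lambda>i. ln \<bar>l2 i\<bar>) E" for E
    using flow_density_scale[OF t(1), of C1 "\<lambda>i. ln \<bar>l1 i\<bar>" E]
    unfolding flow_density_def by (simp only: flow_eq sum_eq)
  then show "density_family (diag_wrt C1 l1) = density_family (diag_wrt C2 l2)"
    by (simp add: density_family_eq_flow_density[OF C1 l1] density_family_eq_flow_density[OF C2 l2])
qed

section \<open>Trivial equivalence and the integer lattice\<close>

lemma diag_map_integer_lattice:
  assumes "\<And>i. a i \<in> \<int>"
  shows "diag_map a ` integer_lattice \<subseteq> integer_lattice"
  using assms by (auto simp: diag_map_def integer_lattice_def)

text \<open>In the first case (k^q)^(p/q) = k^p. In the second, with g the gcd of the exponents, |l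
  i|^t = b^(m * n i / g), and g divides n i.\<close>

lemma trivially_equivalent_integer_eigenvalues:
  fixes l :: "'n::finite \<Rightarrow> real"
  assumes l: "\<And>i. 1 < \<bar>l i\<bar>" and te: "trivially_equivalent l A B"
  obtains t where "t > 0" "linear_powr A t = B" "\<And>i. \<bar>l i\<bar> \<in> \<int>" "\<And>i. \<bar>l i\<bar> powr t \<in> \<int>"
proof -
  obtain t where t: "t > 0" "linear_powr A t = B"
    and alt: "(\<exists>p q :: nat. 0 < p \<and> 0 < q \<and> t = real p / real q \<and>
            (\<forall>j. \<exists>k :: nat. \<bar>l j\<bar> = real k ^ q)) \<or>
         (\<exists>(a :: nat) (b :: nat) (n :: 'n \<Rightarrow> nat) (m :: nat).
            (\<forall>j. 0 < n j \<and> \<bar>l j\<bar> = real a ^ n j) \<and> 0 < m \<and>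
            t = real m / real (Gcd (range n)) * (ln (real b) / ln (real a)))"
    using te unfolding trivially_equivalent_def by blast
  have "\<bar>l i\<bar> \<in> \<int> \<and> \<bar>l i\<bar> powr t \<in> \<int>" for i
    using alt
  proof (elim disjE exE conjE)
    fix p q :: nat assume q: "0 < p" "0 < q" "t = real p / real q" "\<forall>j. \<exists>k :: nat. \<bar>l j\<bar> = real k ^ q"
    then obtain k :: nat where k: "\<bar>l i\<bar> = real k ^ q" by blast
    have "k > 0" using k l[of i] q(2) by (cases k) (auto simp: zero_power)
    then have "\<bar>l i\<bar> powr t = real k ^ p"
      using q by (simp add: k powr_realpow[symmetric] powr_powr)
    then show ?thesis by (simp add: k)
  next
    fix a b :: nat and n :: "'n \<Rightarrow> nat" and m :: nat
    assume n: "\<forall>j. 0 < n j \<and> \<bar>l j\<bar> = real a ^ n j" and m: "0 < m"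
      and t_eq: "t = real m / real (Gcd (range n)) * (ln (real b) / ln (real a))"
    have a: "a > 0" using n[rule_format, of i] l[of i] by (cases a) (auto simp: zero_power)
    have "b \<noteq> 0" using t(1) t_eq by (cases "b = 0") auto
    have "ln (real a) \<noteq> 0" using t(1) t_eq by (cases "ln (real a) = 0") auto
    have "Gcd (range n) dvd n i" by simp
    then obtain c where c: "n i = Gcd (range n) * c" by blast
    have "Gcd (range n) \<noteq> 0" using n c by (metis mult_zero_left less_irrefl)
    have "\<bar>l i\<bar> powr t = exp (t * (real (n i) * ln (real a)))"
      using n a by (simp add: powr_def ln_realpow)
    also have "t * (real (n i) * ln (real a)) = real (m * c) * ln (real b)"
      using \<open>ln (real a) \<noteq> 0\<close> \<open>Gcd (range n) \<noteq> 0\<close> unfolding t_eq c by (simp add: field_simps)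
    also have "exp \<dots> = real b ^ (m * c)"
      using \<open>b \<noteq> 0\<close> by (simp only: exp_of_nat_mult) simp
    finally show ?thesis using n by simp
  qed
  then show ?thesis using that t by blast
qed

theorem proposition22:
  fixes A1 A2 C1 C2 A1' A2' :: "real^'n \<Rightarrow> real^'n"
    and l1 l2 :: "'n \<Rightarrow> real"
  assumes "expansive A1" "adjoint A1 = A1"
    and "expansive A2" "adjoint A2 = A2"
    and "linear C1" "bij C1" "A1 = C1 \<circ> diag_map l1 \<circ> inv C1"
    and "linear C2" "bij C2" "A2 = C2 \<circ> diag_map l2 \<circ> inv C2"
    and "A1' = C1 \<circ> diag_map (\<lambda>j. \<bar>l1 j\<bar>) \<circ> inv C1"
    and "A2' = C2 \<circ> diag_map (\<lambda>j. \<bar>l2 j\<bar>) \<circ> inv C2"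
  shows "(density_family A1 = density_family A2 \<longleftrightarrow> (\<exists>t>0. linear_powr A1' t = A2')) \<and>
    ((\<exists>a1. A1 = diag_map a1) \<and> (\<exists>a2. A2 = diag_map a2) \<and> trivially_equivalent l1 A1' A2' \<longrightarrow>
      A1 ` integer_lattice \<subseteq> integer_lattice \<and>
      A2 ` integer_lattice \<subseteq> integer_lattice \<and>
      density_family A1 = density_family A2)"
proof (intro conjI impI; (elim conjE exE)?)
  note C1 = assms(5,6) and C2 = assms(8,9)
  have A: "A1 = diag_wrt C1 l1" "A2 = diag_wrt C2 l2"
    "A1' = diag_wrt C1 (\<lambda>j. \<bar>l1 j\<bar>)" "A2' = diag_wrt C2 (\<lambda>j. \<bar>l2 j\<bar>)"
    using assms by (simp_all add: diag_wrt_def)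
  have l1: "1 < \<bar>l1 i\<bar>" and l2: "1 < \<bar>l2 i\<bar>" for i
    using expansive_eigenvalue[OF C1] expansive_eigenvalue[OF C2] assms(1,3) A by auto
  show iff: "density_family A1 = density_family A2 \<longleftrightarrow> (\<exists>t>0. linear_powr A1' t = A2')"
    using density_family_eq_iff[OF C1 C2 l1 l2] assms(2,4) by (simp add: A)
  assume "trivially_equivalent l1 A1' A2'"
  then obtain t where t: "t > 0" "linear_powr A1' t = A2'"
    and int1: "\<And>i. \<bar>l1 i\<bar> \<in> \<int>" and int_powr: "\<And>i. \<bar>l1 i\<bar> powr t \<in> \<int>"
    using trivially_equivalent_integer_eigenvalues[of l1, OF l1] by blast
  show "density_family A1 = density_family A2" using iff t by blast
  have "0 < \<bar>l1 i\<bar>" for i using l1[of i] by linarith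
  then have "diag_wrt C1 (\<lambda>i. \<bar>l1 i\<bar> powr t) = diag_wrt C2 (\<lambda>i. \<bar>l2 i\<bar>)"
    using t(2) by (simp add: A linear_powr_diag_wrt[OF C1])
  note sub = diag_wrt_eigenvalues_subset[OF C1 C2 this]
  have int2: "\<bar>l2 i\<bar> \<in> \<int>" for i
  proof -
    obtain k where "\<bar>l2 i\<bar> = \<bar>l1 k\<bar> powr t" using sub by blast
    then show ?thesis using int_powr by simp
  qed
  \<comment> \<open>The canonical entries \<open>a\<close> need not be listed in the order of
    \<open>l\<close>, but each is one of the eigenvalues and so an integer up to sign.\<close>
  have lattice: "A ` integer_lattice \<subseteq> integer_lattice"
    if "A = diag_map a" "A = diag_wrt C l" "linear C" "bij C" "\<And>i. \<bar>l i\<bar> \<in> \<int>"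
    for A C :: "real^'n \<Rightarrow> real^'n" and a l
  proof -
    have "diag_wrt C l = diag_wrt id a"
      using that(1,2) by (simp add: diag_wrt_def[of id])
    from diag_wrt_eigenvalues_subset[OF that(3,4) linear_id bij_id this]
    have "a i \<in> range l" for i by blast
    then have "a i \<in> \<int>" for i using that(5) by (metis imageE abs_if Ints_minus minus_minus)
    then show ?thesis unfolding that(1) by (rule diag_map_integer_lattice)
  qed
  fix a1 a2 assume "A1 = diag_map a1" "A2 = diag_map a2"
  then show "A1 ` integer_lattice \<subseteq> integer_lattice" "A2 ` integer_lattice \<subseteq> integer_lattice"
    using lattice A C1 C2 int1 int2 by blast+
qed

end
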